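(* Let $\mathbf W_t=(Z_t,X_t,Y_t)^\top$, $t\in\mathbb Z$, follow the non-negative stochastic recurrence equation $\mathbf W_t=\mathbf A_t\mathbf W_{t-1}+\mathbf B_t$ with $(\mathbf A_t,\mathbf B_t)_{t\in\mathbb Z}$ i.i.d. and entries denoted as in the context, and assume: (B1) $\mathbb E[\log\|\mathbf A_t\|]<0$ and $\mathbb E[\log^+|\mathbf B_t|]<\infty$; (B2) $\varepsilon_t^z,\varepsilon_t^x,\varepsilon_t^y$ are independent for all $t\in\mathbb Z$; (B4) $A^i_{j,t}>0$ almost surely for all $t\in\mathbb Z$ and all $j\in\{1,2,3\}$, $i\in\{z,x,y\}$ satisfying $P(A^i_{j,t}=0)\ne 1$. Then the estimator $\hat\Gamma_{\mathbf X\to\mathbf Y\mid\mathbf Z}=\frac1{|S_1|}\sum_{t\in S_1}F(Y_{t+1})$, with $S_1$ as in the context, satisfies $$\hat\Gamma_{\mathbf X\to\mathbf Y\mid\mathbf Z}\overset{P}{\to}1\ \text{ as }n\to\infty\iff\Gamma_{\mathbf X\to\mathbf Y\mid\mathcal C}=1.$$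
   Context: Notation. $X_t,Y_t,Z_t$ are real-valued. $\mathbf A_t$ is the $3\times3$ random matrix whose rows are $(A^z_{1,t},A^z_{2,t},A^z_{3,t})$, $(A^x_{1,t},A^x_{2,t},A^x_{3,t})$, $(A^y_{1,t},A^y_{2,t},A^y_{3,t})$, and $\mathbf B_t=(B^z_t,B^x_t,B^y_t)^\top$. For $i\in\{z,x,y\}$, $\varepsilon^i_t=(A^i_{1,t},A^i_{2,t},A^i_{3,t},B^i_t)^\top$. "Non-negative" means all entries of $\mathbf A_t$ and $\mathbf B_t$ (hence of $\mathbf W_t$) are almost surely non-negative. The variables $B^x_t,B^y_t$ are supported on some neighborhood of infinity. $\|\cdot\|$ is the operator norm, $\log^+x=\max\{\log x,0\}$. Under (B1), $\mathbf W$ is the strictly stationary ergodic solution $\mathbf W_t=\sum_{i\ge0}\mathbf A_t\cdots\mathbf A_{t-i+1}\mathbf B_{t-i}$ (empty product is the identity). Coefficient. $\mathrm{past}(t)=(t,t-1,\dots)$, $\mathcal C^{-\mathbf X}_t=\sigma(\mathbf Y_{\mathrm{past}(t)},\mathbf Z_{\mathrm{past}(t)})$. $F$ is a cumulative distribution function with $F(x)<1$ for all $x\in\mathbb R$. $\Gamma_{\mathbf X\to\mathbf Y\mid\mathcal C}=\lim_{v\to\infty}\mathbb E[F(Y_{t+1})\mid X_t>v,\mathcal C_t^{-\mathbf X}]$ (limit assumed to exist a.s.; equality to $1$ is a.s.; independent of $t$ by stationarity), where $\mathbb E[\,\cdot\mid X_t>v,\mathcal G]=\mathbb E[\,\cdot\,\mathbf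 1\{X_t>v\}\mid\mathcal G]/P(X_t>v\mid\mathcal G)$. Estimator. One observes $(X_t,Y_t,Z_t)$, $t=1,\dots,n$. $S_1=\{t\in\{1,\dots,n-1\}:X_t\ge\tau_n^X,\ Y_t\le\tau_Y,\ Z_t\le\tau_Z\}$, where $\boldsymbol\tau=(\tau_Y,\tau_Z)$ is a fixed constant and $\tau_n^X\to\infty$ is a sequence such that $|S_1|\to\infty$ in probability. *)

theory Defs
  imports "HOL-Probability.Probability"
begin

text \<open>
  Expectations with values in \<open>[-\<infinity>, \<infinity>]\<close>. An operator norm may vanish with positive probability,
  so the logarithm takes the value \<open>-\<infinity>\<close> at 0 (whereas \<open>ln 0 = 0\<close> in HOL), and the expectation of
  the negative part may be infinite. If both parts have infinite expectation the value is
  \<open>\<infinity> - \<infinity> = \<infinity>\<close>, so \<open>ext_expectation M f < 0\<close> entails that the positive part is integrable.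
\<close>

definition ext_log :: "real \<Rightarrow> ereal" where
  "ext_log x = (if x \<le> 0 then -\<infinity> else ereal (ln x))"

definition ext_expectation :: "'a measure \<Rightarrow> ('a \<Rightarrow> ereal) \<Rightarrow> ereal" where
  "ext_expectation M f =
     enn2ereal (\<integral>\<^sup>+ \<omega>. e2ennreal (f \<omega>) \<partial>M) - enn2ereal (\<integral>\<^sup>+ \<omega>. e2ennreal (- f \<omega>) \<partial>M)"

definition dist_support :: "'a::topological_space measure \<Rightarrow> 'a set" where
  "dist_support N = {x. \<forall>U. open U \<longrightarrow> x \<in> U \<longrightarrow> emeasure N U > 0}"

text \<open>\<open>sre_prod A t i\<close> is the product \<open>A t ** A (t - 1) ** \<dots> ** A (t - i + 1)\<close>.\<close>

primrec sre_prod :: "(int \<Rightarrow> real^'d^'d) \<Rightarrow> int \<Rightarrow> nat \<Rightarrow> real^'d^'d" where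
  "sre_prod A t 0 = mat 1"
| "sre_prod A t (Suc i) = sre_prod A t i ** A (t - int i)"

definition past_algebra ::
    "'a measure \<Rightarrow> (int \<Rightarrow> 'a \<Rightarrow> real) \<Rightarrow> (int \<Rightarrow> 'a \<Rightarrow> real) \<Rightarrow> int \<Rightarrow> 'a measure" where
  "past_algebra M Y Z t =
     vimage_algebra (space M) (\<lambda>\<omega>. \<lambda>s\<in>{..t}. (Y s \<omega>, Z s \<omega>)) (\<Pi>\<^sub>M s\<in>{..t}. borel)"

text \<open>\<open>E[f | E, G] = E[f 1_E | G] / P(E | G)\<close>\<close>

definition cond_exp_event ::
    "'a measure \<Rightarrow> 'a measure \<Rightarrow> 'a set \<Rightarrow> ('a \<Rightarrow> real) \<Rightarrow> 'a \<Rightarrow> real" where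
  "cond_exp_event M G E f \<omega> =
     real_cond_exp M G (\<lambda>w. f w * indicator E w) \<omega> / real_cond_exp M G (indicator E) \<omega>"

text \<open>
  The coefficient is an almost sure limit of conditional expectations, each of which is only
  determined up to a null set. Along uncountably many thresholds \<open>v\<close> such a limit would depend on the
  chosen versions; it is therefore taken along rational \<open>v\<close>, which makes it independent of them. For
  the versions obtained from a regular conditional distribution, numerator and denominator are
  right-continuous in \<open>v\<close>, so that the limits along rational and along real \<open>v\<close> agree.
\<close>

abbreviation threshold_at_top :: "real filter" where
  "threshold_at_top \<equiv> inf at_top (principal \<rat>)"

definition tail_cond_exp ::
    "'a measure \<Rightarrow> (real \<Rightarrow> real) \<Rightarrow> (int \<Rightarrow> 'a \<Rightarrow> real) \<Rightarrow> (int \<Rightarrow> 'a \<Rightarrow> real) \<Rightarrow> (int \<Rightarrow> 'a \<Rightarrow> real)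
       \<Rightarrow> int \<Rightarrow> 'a \<Rightarrow> real \<Rightarrow> real" where
  "tail_cond_exp M F X Y Z t \<omega> v =
     cond_exp_event M (past_algebra M Y Z t) {w \<in> space M. X t w > v} (\<lambda>w. F (Y (t + 1) w)) \<omega>"

definition causal_tail_coeff ::
    "'a measure \<Rightarrow> (real \<Rightarrow> real) \<Rightarrow> (int \<Rightarrow> 'a \<Rightarrow> real) \<Rightarrow> (int \<Rightarrow> 'a \<Rightarrow> real) \<Rightarrow> (int \<Rightarrow> 'a \<Rightarrow> real)
       \<Rightarrow> int \<Rightarrow> 'a \<Rightarrow> real" where
  "causal_tail_coeff M F X Y Z t \<omega> = Lim threshold_at_top (tail_cond_exp M F X Y Z t \<omega>)"

definition exceedance_times ::
    "(int \<Rightarrow> 'a \<Rightarrow> real) \<Rightarrow> (int \<Rightarrow> 'a \<Rightarrow> real) \<Rightarrow> (int \<Rightarrow> 'a \<Rightarrow> real)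
       \<Rightarrow> (nat \<Rightarrow> real) \<Rightarrow> real \<Rightarrow> real \<Rightarrow> nat \<Rightarrow> 'a \<Rightarrow> int set" where
  "exceedance_times X Y Z \<tau>\<^sub>X \<tau>\<^sub>Y \<tau>\<^sub>Z n \<omega> =
     {t \<in> {1..int n - 1}. X t \<omega> \<ge> \<tau>\<^sub>X n \<and> Y t \<omega> \<le> \<tau>\<^sub>Y \<and> Z t \<omega> \<le> \<tau>\<^sub>Z}"

definition tail_coeff_estimator ::
    "(real \<Rightarrow> real) \<Rightarrow> (int \<Rightarrow> 'a \<Rightarrow> real) \<Rightarrow> (int \<Rightarrow> 'a \<Rightarrow> real) \<Rightarrow> (int \<Rightarrow> 'a \<Rightarrow> real)
       \<Rightarrow> (nat \<Rightarrow> real) \<Rightarrow> real \<Rightarrow> real \<Rightarrow> nat \<Rightarrow> 'a \<Rightarrow> real" where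
  "tail_coeff_estimator F X Y Z \<tau>\<^sub>X \<tau>\<^sub>Y \<tau>\<^sub>Z n \<omega> =
     (\<Sum>t \<in> exceedance_times X Y Z \<tau>\<^sub>X \<tau>\<^sub>Y \<tau>\<^sub>Z n \<omega>. F (Y (t + 1) \<omega>))
       / real (card (exceedance_times X Y Z \<tau>\<^sub>X \<tau>\<^sub>Y \<tau>\<^sub>Z n \<omega>))"

definition converges_in_prob :: "'a measure \<Rightarrow> (nat \<Rightarrow> 'a \<Rightarrow> real) \<Rightarrow> real \<Rightarrow> bool" where
  "converges_in_prob M S c \<longleftrightarrow>
     (\<forall>e>0. (\<lambda>n. measure M {\<omega> \<in> space M. \<bar>S n \<omega> - c\<bar> > e}) \<longlonglongrightarrow> 0)"

definition diverges_in_prob :: "'a measure \<Rightarrow> (nat \<Rightarrow> 'a \<Rightarrow> real) \<Rightarrow> bool" where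
  "diverges_in_prob M S \<longleftrightarrow>
     (\<forall>K. (\<lambda>n. measure M {\<omega> \<in> space M. S n \<omega> > K}) \<longlonglongrightarrow> 1)"

end

theory Submission
  imports Defs "HOL-Real_Asymp.Real_Asymp"
begin

text \<open>
  Let \<open>a\<close> be the coefficient of \<open>X t\<close> in the equation for \<open>Y (t + 1)\<close>. The noise at time \<open>t + 1\<close> is
  independent of the past up to time \<open>t\<close>. If \<open>a > 0\<close> almost surely, then \<open>X t \<ge> v\<close> forces
  \<open>Y (t + 1) \<ge> a v\<close> and \<open>E F(a v) \<rightarrow> 1\<close>, so both sides of the equivalence hold; for the coefficient one
  also needs that \<open>X t > v\<close> has positive conditional probability, which follows from \<open>X t \<ge> B\<^sup>x t\<close> and
  the independence of the \<open>x\<close>-row of the noise from \<open>Y s, Z s\<close>, \<open>s \<le> t\<close>. If \<open>a = 0\<close> almost surely, then on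
  \<open>Y t, Z t \<le> c\<close> the value \<open>F (Y (t + 1))\<close> is at most a function of the noise at time \<open>t + 1\<close> whose mean
  is less than 1, and both sides fail. In both cases the estimator is compared with an average, over the random
  but predictable set of exceedance times, of i.i.d. variables in \<open>[0, 1]\<close>; if \<open>E exp g \<le> 1\<close>, then the
  product of \<open>exp g\<close> over a predictable set has mean at most 1, and Markov's inequality gives
  exponential tails in the number of selected times.
\<close>

subsection \<open>Measurability of the stationary solution\<close>

lemma borel_measurable_vecI:
  fixes f :: "'a \<Rightarrow> 'b::euclidean_space^'n"
  assumes "\<And>i. (\<lambda>x. f x $ i) \<in> borel_measurable M"
  shows "f \<in> borel_measurable M"
proof (subst borel_measurable_euclidean_space, safe)
  fix b :: "'b^'n" assume "b \<in> Basis"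
  then obtain i u where b: "b = axis i u" by (auto simp: Basis_vec_def)
  show "(\<lambda>x. f x \<bullet> b) \<in> borel_measurable M"
    unfolding b inner_axis using assms[of i] by measurable
qed

lemma borel_measurable_vec_component [measurable (raw)]:
  fixes f :: "'a \<Rightarrow> 'b::euclidean_space^'n"
  assumes "f \<in> borel_measurable M"
  shows "(\<lambda>x. f x $ i) \<in> borel_measurable M"
proof -
  have "(\<lambda>x :: 'b^'n. x $ i) \<in> borel_measurable borel"
    by (intro borel_measurable_continuous_onI continuous_intros)
  from measurable_compose[OF assms this] show ?thesis .
qed

lemma borel_measurable_matrix_mult [measurable (raw)]:
  fixes f :: "'a \<Rightarrow> real^'n^'m" and g :: "'a \<Rightarrow> real^'k^'n"
  assumes [measurable]: "f \<in> borel_measurable M" "g \<in> borel_measurable M"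
  shows "(\<lambda>x. f x ** g x) \<in> borel_measurable M"
  by (intro borel_measurable_vecI) (simp add: matrix_matrix_mult_def)

lemma borel_measurable_matrix_vector_mult [measurable (raw)]:
  fixes f :: "'a \<Rightarrow> real^'n^'m" and g :: "'a \<Rightarrow> real^'n"
  assumes [measurable]: "f \<in> borel_measurable M" "g \<in> borel_measurable M"
  shows "(\<lambda>x. f x *v g x) \<in> borel_measurable M"
  by (intro borel_measurable_vecI) (simp add: matrix_vector_mult_def)

lemma sre_prod_cong:
  assumes "\<And>s. s \<le> t \<Longrightarrow> A s = A' s"
  shows "sre_prod A t i = sre_prod A' t i"
  using assms by (induction i) auto

lemma sre_prod_nonneg:
  fixes A :: "int \<Rightarrow> real^'d^'d"
  assumes "\<And>s i j. 0 \<le> A s $ i $ j"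
  shows "0 \<le> sre_prod A t k $ i $ j"
  using assms
  by (induction k arbitrary: i j) (auto simp: mat_def matrix_matrix_mult_def intro!: sum_nonneg)

lemma borel_measurable_sre_prod:
  fixes A :: "int \<Rightarrow> 'a \<Rightarrow> real^'d^'d"
  assumes [measurable]: "\<And>s. s \<le> t \<Longrightarrow> A s \<in> borel_measurable M"
  shows "(\<lambda>x. sre_prod (\<lambda>s. A s x) t k) \<in> borel_measurable M"
  by (induction k) auto

text \<open>The series solution as a deterministic functional of a noise path \<open>h\<close>. It
  is total, with an unspecified value where the series diverges, so \<open>W\<close> agrees with it
  only almost surely. Its purpose is to exhibit \<open>W\<close> as a function of past
  noise.\<close>

definition sre_solution :: "int \<Rightarrow> (int \<Rightarrow> (real^'d^'d) \<times> (real^'d)) \<Rightarrow> real^'d" where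
  "sre_solution t h = (\<Sum>i. sre_prod (\<lambda>s. fst (h s)) t i *v snd (h (t - int i)))"

lemma sre_solution_cong:
  assumes "\<And>s. s \<le> t \<Longrightarrow> h s = h' s"
  shows "sre_solution t h = sre_solution t h'"
proof -
  have "sre_prod (\<lambda>s. fst (h s)) t i = sre_prod (\<lambda>s. fst (h' s)) t i" for i
    by (rule sre_prod_cong) (simp add: assms)
  then show ?thesis by (simp add: sre_solution_def assms)
qed

text \<open>Stated on the product over \<open>{..t}\<close> for every \<open>s \<le> t\<close>,
  because a single history up to \<open>t\<close> has to carry all earlier values of the process at
  once.\<close>

lemma sre_solution_measurable:
  assumes "s \<le> t"
  shows "sre_solution s \<in> borel_measurable (\<Pi>\<^sub>M r\<in>{..t}. (borel :: ((real^'d^'d) \<times> (real^'d)) measure))"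
proof -
  have *: "(\<lambda>h. h r) \<in> measurable (\<Pi>\<^sub>M r\<in>{..t}. (borel :: ((real^'d^'d) \<times> (real^'d)) measure)) borel"
    if "r \<le> t" for r
    by (rule measurable_component_singleton) (use that in auto)
  have fst_meas [measurable]: "(\<lambda>h. fst (h r)) \<in> borel_measurable (\<Pi>\<^sub>M r\<in>{..t}. (borel :: ((real^'d^'d) \<times> (real^'d)) measure))"
    and [measurable]: "(\<lambda>h. snd (h r)) \<in> borel_measurable (\<Pi>\<^sub>M r\<in>{..t}. (borel :: ((real^'d^'d) \<times> (real^'d)) measure))"
    if "r \<le> t" for r
    using *[OF that] by (simp_all add: borel_prod[symmetric])
  have [measurable]: "(\<lambda>h. sre_prod (\<lambda>s. fst (h s)) s k) \<in> borel_measurable (\<Pi>\<^sub>M r\<in>{..t}. (borel :: ((real^'d^'d) \<times> (real^'d)) measure))" for k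
    by (intro borel_measurable_sre_prod fst_meas) (use assms in simp)
  have [simp]: "s - int i \<le> t" for i using assms by simp
  show ?thesis unfolding sre_solution_def
    by measurable
qed

subsection \<open>Independence and conditional expectation\<close>

context prob_space
begin

text \<open>\<^const>\<open>indep_var\<close> forces both variables to take values in the same type; the following
  notion does not.\<close>

definition indep_pair where
  "indep_pair S U T V \<longleftrightarrow> U \<in> measurable M S \<and> V \<in> measurable M T \<and>
     distr M S U \<Otimes>\<^sub>M distr M T V = distr M (S \<Otimes>\<^sub>M T) (\<lambda>\<omega>. (U \<omega>, V \<omega>))"

lemma indep_pair_indep_var: "indep_pair S U T V \<longleftrightarrow> indep_var S U T V"
  by (simp add: indep_pair_def indep_var_distribution_eq)

lemma indep_pair_rv:
  assumes "indep_pair S U T V"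
  shows "U \<in> measurable M S" "V \<in> measurable M T"
  using assms by (auto simp: indep_pair_def)

text \<open>A product of two probability measures is determined by its values on rectangles. The
  criterion is phrased with integrals of indicators so that the Tonelli rule below can verify it
  directly.\<close>

lemma indep_pairI:
  assumes [measurable]: "U \<in> measurable M S" "V \<in> measurable M T"
    and eq: "\<And>P Q. P \<in> sets S \<Longrightarrow> Q \<in> sets T \<Longrightarrow>
      (\<integral>\<^sup>+\<omega>. indicator P (U \<omega>) * indicator Q (V \<omega>) \<partial>M)
        = (\<integral>\<^sup>+\<omega>. indicator P (U \<omega>) \<partial>M) * (\<integral>\<^sup>+\<omega>. indicator Q (V \<omega>) \<partial>M)"
  shows "indep_pair S U T V"
proof -
  interpret U: prob_space "distr M S U" by (rule prob_space_distr) measurable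
  interpret V: prob_space "distr M T V" by (rule prob_space_distr) measurable
  have "emeasure (distr M S U) P * emeasure (distr M T V) Q
      = emeasure (distr M (S \<Otimes>\<^sub>M T) (\<lambda>\<omega>. (U \<omega>, V \<omega>))) (P \<times> Q)"
    if "P \<in> sets (distr M S U)" "Q \<in> sets (distr M T V)" for P Q
  proof -
    have [measurable]: "P \<in> sets S" "Q \<in> sets T" using that by auto
    have "emeasure (distr M (S \<Otimes>\<^sub>M T) (\<lambda>\<omega>. (U \<omega>, V \<omega>))) (P \<times> Q)
        = (\<integral>\<^sup>+\<omega>. indicator P (U \<omega>) * indicator Q (V \<omega>) \<partial>M)"
      by (subst nn_integral_indicator[symmetric], simp, subst nn_integral_distr)
         (auto simp: indicator_times)
    moreover have "emeasure (distr M S U) P = (\<integral>\<^sup>+\<omega>. indicator P (U \<omega>) \<partial>M)"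
      by (subst nn_integral_indicator[symmetric], simp, subst nn_integral_distr) auto
    moreover have "emeasure (distr M T V) Q = (\<integral>\<^sup>+\<omega>. indicator Q (V \<omega>) \<partial>M)"
      by (subst nn_integral_indicator[symmetric], simp, subst nn_integral_distr) auto
    ultimately show ?thesis using eq[of P Q] by simp
  qed
  then have "distr M S U \<Otimes>\<^sub>M distr M T V = distr M (S \<Otimes>\<^sub>M T) (\<lambda>\<omega>. (U \<omega>, V \<omega>))"
    by (intro pair_measure_eqI U.sigma_finite_measure_axioms V.sigma_finite_measure_axioms) auto
  then show ?thesis by (simp add: indep_pair_def)
qed

text \<open>Tonelli for the joint law, pulled back to \<open>M\<close>: the second variable may be
  evaluated at an independent copy \<open>\<omega>'\<close> of the sample point.\<close>

lemma nn_integral_indep_pair: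
  assumes ind: "indep_pair S U T V" and [measurable]: "f \<in> borel_measurable (S \<Otimes>\<^sub>M T)"
  shows "(\<integral>\<^sup>+\<omega>. f (U \<omega>, V \<omega>) \<partial>M) = (\<integral>\<^sup>+\<omega>. (\<integral>\<^sup>+\<omega>'. f (U \<omega>, V \<omega>') \<partial>M) \<partial>M)"
proof -
  note [measurable] = indep_pair_rv[OF ind]
  interpret V: prob_space "distr M T V" by (rule prob_space_distr) measurable
  have "(\<integral>\<^sup>+\<omega>. f (U \<omega>, V \<omega>) \<partial>M) = (\<integral>\<^sup>+x. f x \<partial>distr M (S \<Otimes>\<^sub>M T) (\<lambda>\<omega>. (U \<omega>, V \<omega>)))"
    by (subst nn_integral_distr) auto
  also have "\<dots> = (\<integral>\<^sup>+x. f x \<partial>(distr M S U \<Otimes>\<^sub>M distr M T V))"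
    using ind by (simp add: indep_pair_def)
  also have "\<dots> = (\<integral>\<^sup>+x. \<integral>\<^sup>+y. f (x, y) \<partial>distr M T V \<partial>distr M S U)"
    by (subst V.nn_integral_fst[symmetric]) auto
  also have "\<dots> = (\<integral>\<^sup>+\<omega>. (\<integral>\<^sup>+y. f (U \<omega>, y) \<partial>distr M T V) \<partial>M)"
    by (subst nn_integral_distr) auto
  also have "\<dots> = (\<integral>\<^sup>+\<omega>. (\<integral>\<^sup>+\<omega>'. f (U \<omega>, V \<omega>') \<partial>M) \<partial>M)"
    by (intro nn_integral_cong, subst nn_integral_distr) (auto dest: measurable_space)
  finally show ?thesis .
qed

lemma nn_integral_indep_pair_mult:
  fixes f g :: "_ \<Rightarrow> ennreal"
  assumes ind: "indep_pair S U T V" and [measurable]: "f \<in> borel_measurable S" "g \<in> borel_measurable T"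
  shows "(\<integral>\<^sup>+\<omega>. f (U \<omega>) * g (V \<omega>) \<partial>M) = (\<integral>\<^sup>+\<omega>. f (U \<omega>) \<partial>M) * (\<integral>\<^sup>+\<omega>. g (V \<omega>) \<partial>M)"
proof -
  note [measurable] = indep_pair_rv[OF ind]
  show ?thesis
    using nn_integral_indep_pair[OF ind, of "\<lambda>x. f (fst x) * g (snd x)"]
    by (simp add: nn_integral_cmult nn_integral_multc)
qed

lemma indep_pair_compose:
  assumes ind: "indep_pair S U T V"
    and [measurable]: "f \<in> measurable S S'" "g \<in> measurable T T'"
  shows "indep_pair S' (\<lambda>\<omega>. f (U \<omega>)) T' (\<lambda>\<omega>. g (V \<omega>))"
proof (rule indep_pairI)
  note [measurable] = indep_pair_rv[OF ind]
  show "(\<lambda>\<omega>. f (U \<omega>)) \<in> measurable M S'" "(\<lambda>\<omega>. g (V \<omega>)) \<in> measurable M T'" by measurable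
  show "(\<integral>\<^sup>+\<omega>. indicator P (f (U \<omega>)) * indicator Q (g (V \<omega>)) \<partial>M)
      = (\<integral>\<^sup>+\<omega>. indicator P (f (U \<omega>)) \<partial>M) * (\<integral>\<^sup>+\<omega>. indicator Q (g (V \<omega>)) \<partial>M)"
    if [measurable]: "P \<in> sets S'" "Q \<in> sets T'" for P Q
    by (rule nn_integral_indep_pair_mult[OF ind, of "\<lambda>u. indicator P (f u)" "\<lambda>v. indicator Q (g v)"])
       measurable
qed

text \<open>Freezing \<open>U\<close> by Tonelli leaves, for each value of \<open>U\<close>, a
  function of \<open>f (V \<omega>)\<close> against a function of \<open>g (V \<omega>)\<close>, and
  these factor by \<open>split\<close>. It is applied with \<open>U\<close> the history before time
  \<open>t\<close>, \<open>V\<close> the noise at time \<open>t\<close>, \<open>g\<close> one row of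
  that noise and \<open>f\<close> the other rows.\<close>

lemma indep_pair_refine:
  assumes ind: "indep_pair S U T V"
    and [measurable]: "f \<in> measurable T S'" "g \<in> measurable T T'"
    and split: "indep_pair S' (\<lambda>\<omega>. f (V \<omega>)) T' (\<lambda>\<omega>. g (V \<omega>))"
  shows "indep_pair (S \<Otimes>\<^sub>M S') (\<lambda>\<omega>. (U \<omega>, f (V \<omega>))) T' (\<lambda>\<omega>. g (V \<omega>))"
proof (rule indep_pairI)
  note [measurable] = indep_pair_rv[OF ind]
  show "(\<lambda>\<omega>. (U \<omega>, f (V \<omega>))) \<in> measurable M (S \<Otimes>\<^sub>M S')" "(\<lambda>\<omega>. g (V \<omega>)) \<in> measurable M T'"
    by measurable
  fix P Q assume [measurable]: "P \<in> sets (S \<Otimes>\<^sub>M S')" "Q \<in> sets T'"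
  have "(\<integral>\<^sup>+\<omega>. indicator P (U \<omega>, f (V \<omega>)) * indicator Q (g (V \<omega>)) \<partial>M)
      = (\<integral>\<^sup>+\<omega>. (\<integral>\<^sup>+\<omega>'. indicator P (U \<omega>, f (V \<omega>')) * indicator Q (g (V \<omega>')) \<partial>M) \<partial>M)"
    using nn_integral_indep_pair[OF ind,
        of "\<lambda>z. indicator P (fst z, f (snd z)) * indicator Q (g (snd z))"]
    by simp
  also have "\<dots> = (\<integral>\<^sup>+\<omega>. (\<integral>\<^sup>+\<omega>'. indicator P (U \<omega>, f (V \<omega>')) \<partial>M) * (\<integral>\<^sup>+\<omega>'. indicator Q (g (V \<omega>')) \<partial>M) \<partial>M)"
  proof (rule nn_integral_cong)
    fix \<omega> assume "\<omega> \<in> space M"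
    then have [measurable]: "U \<omega> \<in> space S" by (auto dest: measurable_space[OF indep_pair_rv(1)[OF ind]])
    show "(\<integral>\<^sup>+\<omega>'. indicator P (U \<omega>, f (V \<omega>')) * indicator Q (g (V \<omega>')) \<partial>M)
      = (\<integral>\<^sup>+\<omega>'. indicator P (U \<omega>, f (V \<omega>')) \<partial>M) * (\<integral>\<^sup>+\<omega>'. indicator Q (g (V \<omega>')) \<partial>M)"
      by (rule nn_integral_indep_pair_mult[OF split, of "\<lambda>w. indicator P (U \<omega>, w)" "indicator Q"])
         measurable
  qed
  also have "\<dots> = (\<integral>\<^sup>+\<omega>. (\<integral>\<^sup>+\<omega>'. indicator P (U \<omega>, f (V \<omega>')) \<partial>M) \<partial>M) * (\<integral>\<^sup>+\<omega>'. indicator Q (g (V \<omega>')) \<partial>M)"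
    by (rule nn_integral_multc) measurable
  also have "(\<integral>\<^sup>+\<omega>. (\<integral>\<^sup>+\<omega>'. indicator P (U \<omega>, f (V \<omega>')) \<partial>M) \<partial>M) = (\<integral>\<^sup>+\<omega>. indicator P (U \<omega>, f (V \<omega>)) \<partial>M)"
    using nn_integral_indep_pair[OF ind, of "\<lambda>z. indicator P (fst z, f (snd z))"] by simp
  finally show "(\<integral>\<^sup>+\<omega>. indicator P (U \<omega>, f (V \<omega>)) * indicator Q (g (V \<omega>)) \<partial>M)
      = (\<integral>\<^sup>+\<omega>. indicator P (U \<omega>, f (V \<omega>)) \<partial>M) * (\<integral>\<^sup>+\<omega>. indicator Q (g (V \<omega>)) \<partial>M)" .
qed

text \<open>After composition with \<open>f\<close> and \<open>g\<close> both variables are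
  real-valued, so the product rule for \<open>indep_var\<close> applies.\<close>

lemma expectation_indep_pair_mult:
  fixes f g :: "_ \<Rightarrow> real"
  assumes ind: "indep_pair S U T V" and [measurable]: "f \<in> borel_measurable S" "g \<in> borel_measurable T"
    and "integrable M (\<lambda>\<omega>. f (U \<omega>))" "integrable M (\<lambda>\<omega>. g (V \<omega>))"
  shows "expectation (\<lambda>\<omega>. f (U \<omega>) * g (V \<omega>)) = expectation (\<lambda>\<omega>. f (U \<omega>)) * expectation (\<lambda>\<omega>. g (V \<omega>))"
  using indep_pair_compose[OF ind, of f borel g borel] assms
  by (intro indep_var_lebesgue_integral) (auto simp: indep_pair_indep_var)

text \<open>A conditional expectation is characterised by its integrals over the sets of
  \<open>G\<close>. When \<open>V\<close> is independent of \<open>H\<close> and \<open>G\<close>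
  jointly, the last assumption is just the product rule with \<open>c\<close> the mean of
  \<open>V\<close>.\<close>

lemma real_cond_exp_indep_factor:
  fixes V H :: "'a \<Rightarrow> real"
  assumes "subalgebra M G" "integrable M H" "integrable M (\<lambda>\<omega>. V \<omega> * H \<omega>)"
    and "\<And>D. D \<in> sets G \<Longrightarrow>
      expectation (\<lambda>\<omega>. V \<omega> * (H \<omega> * indicator D \<omega>)) = c * expectation (\<lambda>\<omega>. H \<omega> * indicator D \<omega>)"
  shows "AE \<omega> in M. real_cond_exp M G (\<lambda>\<omega>. V \<omega> * H \<omega>) \<omega> = c * real_cond_exp M G H \<omega>"
proof -
  interpret finite_measure_subalgebra M G
    by unfold_locales (rule assms(1))
  show ?thesis
  proof (rule real_cond_exp_charact)
    fix D assume D: "D \<in> sets G"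
    then have [measurable]: "D \<in> sets M" using subalg by (auto simp: subalgebra_def)
    have "(\<integral>\<omega>\<in>D. V \<omega> * H \<omega> \<partial>M) = c * (\<integral>\<omega>\<in>D. H \<omega> \<partial>M)"
      using assms(4)[OF D] by (simp add: set_lebesgue_integral_def mult_ac)
    also have "(\<integral>\<omega>\<in>D. H \<omega> \<partial>M) = (\<integral>\<omega>\<in>D. real_cond_exp M G H \<omega> \<partial>M)"
      by (rule real_cond_exp_intA) (use assms D in auto)
    finally show "(\<integral>\<omega>\<in>D. V \<omega> * H \<omega> \<partial>M) = (\<integral>\<omega>\<in>D. c * real_cond_exp M G H \<omega> \<partial>M)"
      by simp
  qed (use assms in \<open>auto intro: real_cond_exp_int\<close>)
qed

subsection \<open>Sums over predictably selected indices\<close>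

context
  fixes T :: "'b measure" and \<epsilon> :: "int \<Rightarrow> 'a \<Rightarrow> 'b"
  assumes indep: "indep_vars (\<lambda>_. T) \<epsilon> UNIV"
begin

lemma innovation_measurable: "\<epsilon> k \<in> measurable M T"
  using indep by (auto simp: indep_vars_def)

lemma history_measurable: "(\<lambda>\<omega>. \<lambda>s\<in>{..k}. \<epsilon> s \<omega>) \<in> measurable M (\<Pi>\<^sub>M s\<in>{..k}. T)"
  by (intro measurable_restrict innovation_measurable)

text \<open>The index blocks \<open>{..k}\<close> and \<open>{k + 1}\<close> are disjoint; the
  second block is then projected to its only coordinate.\<close>

lemma history_innovation_indep:
  "indep_pair (\<Pi>\<^sub>M s\<in>{..k}. T) (\<lambda>\<omega>. \<lambda>s\<in>{..k}. \<epsilon> s \<omega>) T (\<epsilon> (k + 1))"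
proof -
  have "indep_pair (\<Pi>\<^sub>M s\<in>{..k}. T) (\<lambda>\<omega>. \<lambda>s\<in>{..k}. \<epsilon> s \<omega>) (\<Pi>\<^sub>M s\<in>{k + 1}. T) (\<lambda>\<omega>. \<lambda>s\<in>{k + 1}. \<epsilon> s \<omega>)"
    unfolding indep_pair_indep_var by (rule indep_var_restrict[OF indep]) auto
  from indep_pair_compose[OF this, of "\<lambda>h. h" _ "\<lambda>h. h (k + 1)" T] show ?thesis
    by simp
qed

text \<open>The partial products form a supermartingale, since each factor is independent of the event
  that selects it.\<close>

lemma predictable_product_le_1:
  fixes G :: "'b \<Rightarrow> ennreal"
  assumes p: "\<And>k. Measurable.pred (\<Pi>\<^sub>M s\<in>{..k}. T) (p k)"
    and G: "G \<in> borel_measurable T" "\<And>k. (\<integral>\<^sup>+\<omega>. G (\<epsilon> k \<omega>) \<partial>M) \<le> 1"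
  shows "(\<integral>\<^sup>+\<omega>. (\<Prod>k\<in>{a..<a + int m}. if p k (\<lambda>s\<in>{..k}. \<epsilon> s \<omega>) then G (\<epsilon> (k + 1) \<omega>) else 1) \<partial>M) \<le> 1"
proof (induction m)
  case 0
  show ?case by (simp add: emeasure_space_1)
next
  case (Suc m)
  define b where "b = a + int m"
  \<comment> \<open>The product over the first \<open>m\<close> indices as a function of the path up
    to \<open>b\<close>. Since \<open>k < b\<close> gives \<open>k + 1 \<le> b\<close>, the last
    innovation it reads is the one at time \<open>b\<close>, which leaves the innovation at
    \<open>b + 1\<close> independent of it.\<close>
  define q where "q h = (\<Prod>k\<in>{a..<b}. if p k (restrict h {..k}) then G (h (k + 1)) else 1)" for h
  note G(1) [measurable] p [measurable]
  have [measurable]: "q \<in> borel_measurable (\<Pi>\<^sub>M s\<in>{..b}. T)"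
    unfolding q_def
  proof (rule borel_measurable_prod_ennreal)
    fix k assume k: "k \<in> {a..<b}"
    then have [measurable]: "(\<lambda>h. h (k + 1)) \<in> measurable (\<Pi>\<^sub>M s\<in>{..b}. T) T"
      "(\<lambda>h. restrict h {..k}) \<in> measurable (\<Pi>\<^sub>M s\<in>{..b}. T) (\<Pi>\<^sub>M s\<in>{..k}. T)"
      by (auto intro!: measurable_component_singleton measurable_restrict_subset)
    show "(\<lambda>h. if p k (restrict h {..k}) then G (h (k + 1)) else 1) \<in> borel_measurable (\<Pi>\<^sub>M s\<in>{..b}. T)"
      by measurable
  qed
  define H where "H \<omega> = (\<lambda>s\<in>{..b}. \<epsilon> s \<omega>)" for \<omega>
  have q_H: "q (H \<omega>) = (\<Prod>k\<in>{a..<b}. if p k (\<lambda>s\<in>{..k}. \<epsilon> s \<omega>) then G (\<epsilon> (k + 1) \<omega>) else 1)" for \<omega>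
    unfolding q_def H_def by (intro prod.cong) (auto simp: Int_absorb1)
  have ind: "indep_pair (\<Pi>\<^sub>M s\<in>{..b}. T) H T (\<epsilon> (b + 1))"
    unfolding H_def by (rule history_innovation_indep)
  note [measurable] = indep_pair_rv[OF ind]
  have "{a..<a + int (Suc m)} = insert b {a..<b}" by (auto simp: b_def)
  then have "(\<integral>\<^sup>+\<omega>. (\<Prod>k\<in>{a..<a + int (Suc m)}. if p k (\<lambda>s\<in>{..k}. \<epsilon> s \<omega>) then G (\<epsilon> (k + 1) \<omega>) else 1) \<partial>M)
      = (\<integral>\<^sup>+\<omega>. (if p b (H \<omega>) then G (\<epsilon> (b + 1) \<omega>) else 1) * q (H \<omega>) \<partial>M)"
    by (simp add: q_H) (simp add: H_def)
  also have "\<dots> = (\<integral>\<^sup>+\<omega>. (\<integral>\<^sup>+\<omega>'. (if p b (H \<omega>) then G (\<epsilon> (b + 1) \<omega>') else 1) * q (H \<omega>) \<partial>M) \<partial>M)"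
    using nn_integral_indep_pair[OF ind, of "\<lambda>z. (if p b (fst z) then G (snd z) else 1) * q (fst z)"]
    by (simp cong: if_cong)
  also have "\<dots> \<le> (\<integral>\<^sup>+\<omega>. q (H \<omega>) \<partial>M)"
  \<comment> \<open>For a fixed history the new factor has mean at most 1 if index \<open>b\<close>
    is selected, and equals 1 otherwise.\<close>
  proof (rule nn_integral_mono)
    fix \<omega>
    have "(\<integral>\<^sup>+\<omega>'. G (\<epsilon> (b + 1) \<omega>') * q (H \<omega>) \<partial>M) = (\<integral>\<^sup>+\<omega>'. G (\<epsilon> (b + 1) \<omega>') \<partial>M) * q (H \<omega>)"
      by (rule nn_integral_multc) measurable
    also have "\<dots> \<le> 1 * q (H \<omega>)"
      by (intro mult_right_mono G(2)) simp
    finally have "(\<integral>\<^sup>+\<omega>'. G (\<epsilon> (b + 1) \<omega>') * q (H \<omega>) \<partial>M) \<le> 1 * q (H \<omega>)" .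
    then show "(\<integral>\<^sup>+\<omega>'. (if p b (H \<omega>) then G (\<epsilon> (b + 1) \<omega>') else 1) * q (H \<omega>) \<partial>M) \<le> q (H \<omega>)"
      by (cases "p b (H \<omega>)") (simp_all add: emeasure_space_1)
  qed
  also have "\<dots> \<le> 1"
    using Suc.IH unfolding q_H b_def .
  finally show ?case .
qed

text \<open>Chernoff bound with exponent 1: the exponential of the selected sum is a selected
  product of mean at most 1, and Markov's inequality finishes. The bound depends neither on the
  length of the range nor on the selection rule.\<close>

lemma predictable_sum_tail:
  fixes g :: "'b \<Rightarrow> real"
  assumes p: "\<And>k. Measurable.pred (\<Pi>\<^sub>M s\<in>{..k}. T) (p k)"
    and g: "g \<in> borel_measurable T" "\<And>k. (\<integral>\<^sup>+\<omega>. ennreal (exp (g (\<epsilon> k \<omega>))) \<partial>M) \<le> 1"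
  shows "prob {\<omega>\<in>space M. c \<le> (\<Sum>k\<in>{k\<in>{a..b}. p k (\<lambda>s\<in>{..k}. \<epsilon> s \<omega>)}. g (\<epsilon> (k + 1) \<omega>))} \<le> exp (- c)"
proof -
  define D where "D \<omega> = (\<Sum>k\<in>{k\<in>{a..b}. p k (\<lambda>s\<in>{..k}. \<epsilon> s \<omega>)}. g (\<epsilon> (k + 1) \<omega>))" for \<omega>
  note [measurable] = g(1) p history_measurable innovation_measurable
  have D_alt: "D \<omega> = (\<Sum>k\<in>{a..b}. if p k (\<lambda>s\<in>{..k}. \<epsilon> s \<omega>) then g (\<epsilon> (k + 1) \<omega>) else 0)" for \<omega>
    unfolding D_def by (rule sum.inter_filter) simp
  have [measurable]: "D \<in> borel_measurable M"
    unfolding D_alt[abs_def] by measurable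
  have "ennreal (exp (D \<omega>)) = (\<Prod>k\<in>{a..b}. if p k (\<lambda>s\<in>{..k}. \<epsilon> s \<omega>) then ennreal (exp (g (\<epsilon> (k + 1) \<omega>))) else 1)" for \<omega>
    unfolding D_alt exp_sum[OF finite_atLeastAtMost_int]
    by (subst prod_ennreal[symmetric]) (auto intro!: prod.cong)
  \<comment> \<open>Since \<open>nat\<close> truncates at 0, this also covers the empty range
    \<open>b < a\<close>.\<close>
  moreover have "{a..b} = {a..<a + int (nat (b + 1 - a))}" by auto
  ultimately have le_1: "(\<integral>\<^sup>+\<omega>. ennreal (exp (D \<omega>)) \<partial>M) \<le> 1"
    using predictable_product_le_1[OF p, of "\<lambda>x. ennreal (exp (g x))" a "nat (b + 1 - a)"] g by simp
  have "emeasure M {\<omega>\<in>space M. 1 \<le> ennreal (exp (- c)) * ennreal (exp (D \<omega>))}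
      \<le> ennreal (exp (- c)) * (\<integral>\<^sup>+\<omega>. ennreal (exp (D \<omega>)) * indicator (space M) \<omega> \<partial>M)"
    by (rule nn_integral_Markov_inequality) auto
  also have "(\<integral>\<^sup>+\<omega>. ennreal (exp (D \<omega>)) * indicator (space M) \<omega> \<partial>M) = (\<integral>\<^sup>+\<omega>. ennreal (exp (D \<omega>)) \<partial>M)"
    by (intro nn_integral_cong) simp
  also have "ennreal (exp (- c)) * \<dots> \<le> ennreal (exp (- c))"
    using mult_left_mono[OF le_1, of "ennreal (exp (- c))"] by simp
  also have "{\<omega>\<in>space M. 1 \<le> ennreal (exp (- c)) * ennreal (exp (D \<omega>))} = {\<omega>\<in>space M. c \<le> D \<omega>}"
    by (simp add: ennreal_mult[symmetric] exp_add[symmetric] del: ennreal_1 add: ennreal_1[symmetric])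
  finally show ?thesis by (simp add: D_def emeasure_eq_measure)
qed

end

end

subsection \<open>The history of a stationary solution\<close>

text \<open>Here the process enters only through its series representation; the recurrence and the
  identical distribution of the noise are assumed later, where they are used.\<close>

locale stationary_sre = prob_space +
  fixes A :: "int \<Rightarrow> 'a \<Rightarrow> real^'d^'d" and B W :: "int \<Rightarrow> 'a \<Rightarrow> real^'d"
  assumes W_measurable [measurable]: "\<And>t. W t \<in> borel_measurable M"
    and noise_indep: "indep_vars (\<lambda>_. borel) (\<lambda>t \<omega>. (A t \<omega>, B t \<omega>)) UNIV"
    and W_sums: "\<And>t. AE \<omega> in M.
          (\<lambda>i. sre_prod (\<lambda>s. A s \<omega>) t i *v B (t - int i) \<omega>) sums W t \<omega>"
begin

definition history :: "int \<Rightarrow> 'a \<Rightarrow> int \<Rightarrow> (real^'d^'d) \<times> (real^'d)" where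
  "history t \<omega> = (\<lambda>s\<in>{..t}. (A s \<omega>, B s \<omega>))"

lemma noise_measurable: "(\<lambda>\<omega>. (A t \<omega>, B t \<omega>)) \<in> borel_measurable M"
  by (rule innovation_measurable[OF noise_indep])

lemma A_measurable [measurable]: "A t \<in> borel_measurable M"
  and B_measurable [measurable]: "B t \<in> borel_measurable M"
  using noise_measurable[of t] by (simp_all add: borel_prod[symmetric] measurable_pair_iff comp_def)

text \<open>There are only countably many times, so one null set suffices for the whole past of
  \<open>W\<close> to be a function of the noise up to \<open>t\<close>.\<close>

lemma W_eq_solution: "AE \<omega> in M. \<forall>s\<le>t. W s \<omega> = sre_solution s (history t \<omega>)"
proof -
  have "AE \<omega> in M. \<forall>s. (\<lambda>i. sre_prod (\<lambda>s. A s \<omega>) s i *v B (s - int i) \<omega>) sums W s \<omega>"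
    using W_sums by (simp add: AE_all_countable)
  then show ?thesis
  proof (eventually_elim, safe)
    fix \<omega> s assume *: "\<forall>s. (\<lambda>i. sre_prod (\<lambda>s. A s \<omega>) s i *v B (s - int i) \<omega>) sums W s \<omega>" and "s \<le> t"
    then have "sre_solution s (history t \<omega>) = sre_solution s (\<lambda>s. (A s \<omega>, B s \<omega>))"
      by (intro sre_solution_cong) (simp add: history_def)
    with * show "W s \<omega> = sre_solution s (history t \<omega>)"
      by (simp add: sre_solution_def sums_unique)
  qed
qed

lemma history_noise_indep:
  "indep_pair (\<Pi>\<^sub>M s\<in>{..t}. borel) (history t) borel (\<lambda>\<omega>. (A (t + 1) \<omega>, B (t + 1) \<omega>))"
  using history_innovation_indep[OF noise_indep] by (simp add: history_def[abs_def])

text \<open>Selection by the state \<open>W k\<close> is predictable: up to a null set,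
  \<open>R (W k \<omega>)\<close> is a predicate \<open>p k\<close> of the noise history up to
  \<open>k\<close>, while \<open>g\<close> is evaluated at the noise of time \<open>k + 1\<close>.
  Both events therefore have the same probability, and the general tail bound applies to the
  second.\<close>

lemma selected_sum_tail:
  fixes g :: "(real^'d^'d) \<times> (real^'d) \<Rightarrow> real"
  assumes R: "Measurable.pred borel R"
    and g [measurable]: "g \<in> borel_measurable borel" and
      g_exp: "\<And>k. (\<integral>\<^sup>+\<omega>. ennreal (exp (g (A k \<omega>, B k \<omega>))) \<partial>M) \<le> 1"
  shows "prob {\<omega>\<in>space M. c \<le> (\<Sum>k\<in>{k\<in>{a..b}. R (W k \<omega>)}. g (A (k + 1) \<omega>, B (k + 1) \<omega>))} \<le> exp (- c)"
proof -
  define p where "p k h = R (sre_solution k h)" for k h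
  note R [measurable]
  have p: "Measurable.pred (\<Pi>\<^sub>M s\<in>{..k}. borel) (p k)" for k
    unfolding p_def by (rule measurable_compose[OF sre_solution_measurable R]) simp
  have "AE \<omega> in M. \<forall>k. \<forall>s\<le>k. W s \<omega> = sre_solution s (history k \<omega>)"
    using W_eq_solution by (simp add: AE_all_countable)
  then have AE: "AE \<omega> in M. \<forall>k. p k (history k \<omega>) \<longleftrightarrow> R (W k \<omega>)"
  proof eventually_elim
    case (elim \<omega>)
    then have "W k \<omega> = sre_solution k (history k \<omega>)" for k by blast
    then show ?case by (simp add: p_def)
  qed
  note [measurable] = measurable_compose[OF noise_measurable g] p history_measurable[OF noise_indep]
  have [measurable]: "{\<omega>\<in>space M. c \<le> (\<Sum>k\<in>{k\<in>{a..b}. R (W k \<omega>)}. g (A (k + 1) \<omega>, B (k + 1) \<omega>))} \<in> sets M"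
    "{\<omega>\<in>space M. c \<le> (\<Sum>k\<in>{k\<in>{a..b}. p k (\<lambda>s\<in>{..k}. (A s \<omega>, B s \<omega>))}. g (A (k + 1) \<omega>, B (k + 1) \<omega>))} \<in> sets M"
    \<comment> \<open>A sum over a random index set becomes a sum over the fixed range with an
      \<open>if\<close> inside, which is visibly measurable.\<close>
    unfolding sum.inter_filter[OF finite_atLeastAtMost_int] by measurable
  have "prob {\<omega>\<in>space M. c \<le> (\<Sum>k\<in>{k\<in>{a..b}. R (W k \<omega>)}. g (A (k + 1) \<omega>, B (k + 1) \<omega>))}
      = prob {\<omega>\<in>space M. c \<le> (\<Sum>k\<in>{k\<in>{a..b}. p k (\<lambda>s\<in>{..k}. (A s \<omega>, B s \<omega>))}. g (A (k + 1) \<omega>, B (k + 1) \<omega>))}"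
  proof (rule measure_eq_AE)
    show "AE \<omega> in M. \<omega> \<in> {\<omega>\<in>space M. c \<le> (\<Sum>k\<in>{k\<in>{a..b}. R (W k \<omega>)}. g (A (k + 1) \<omega>, B (k + 1) \<omega>))} \<longleftrightarrow>
      \<omega> \<in> {\<omega>\<in>space M. c \<le> (\<Sum>k\<in>{k\<in>{a..b}. p k (\<lambda>s\<in>{..k}. (A s \<omega>, B s \<omega>))}. g (A (k + 1) \<omega>, B (k + 1) \<omega>))}"
      using AE by eventually_elim (simp add: history_def)
  qed measurable
  also have "\<dots> \<le> exp (- c)"
    by (rule predictable_sum_tail[OF noise_indep p g g_exp])
  finally show ?thesis .
qed

section \<open>Conditioning on the past of two coordinates\<close>

lemma past_algebra_subalgebra: "subalgebra M (past_algebra M (\<lambda>s \<omega>. W s \<omega> $ i) (\<lambda>s \<omega>. W s \<omega> $ j) t)"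
proof -
  have "(\<lambda>\<omega>. \<lambda>s\<in>{..t}. (W s \<omega> $ i, W s \<omega> $ j)) \<in> measurable M (\<Pi>\<^sub>M s\<in>{..t}. borel)"
    by (intro measurable_restrict borel_measurable_Pair borel_measurable_vec_component W_measurable)
  from sets_image_in_sets[OF refl this] show ?thesis
    by (simp add: subalgebra_def past_algebra_def)
qed

lemma past_algebra_set_cases:
  assumes "D \<in> sets (past_algebra M (\<lambda>s \<omega>. W s \<omega> $ i) (\<lambda>s \<omega>. W s \<omega> $ j) t)"
  obtains P where "P \<in> sets (\<Pi>\<^sub>M s\<in>{..t}. borel)"
    "\<And>\<omega>. \<omega> \<in> space M \<Longrightarrow> \<omega> \<in> D \<longleftrightarrow> (\<lambda>s\<in>{..t}. (W s \<omega> $ i, W s \<omega> $ j)) \<in> P"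
proof -
  have "(\<lambda>\<omega>. \<lambda>s\<in>{..t}. (W s \<omega> $ i, W s \<omega> $ j)) \<in> space M \<rightarrow> space (\<Pi>\<^sub>M s\<in>{..t}. borel)"
    by (auto simp: space_PiM)
  from sets_vimage_algebra2[OF this] assms that show thesis
    unfolding past_algebra_def by auto
qed

text \<open>Both \<open>f (W t \<omega>)\<close> and every event of \<open>G\<close> are, up to null
  sets, functions of the history up to \<open>t\<close>, hence independent of the noise at
  \<open>t + 1\<close>. Its mean therefore factors out as a constant.\<close>

lemma real_cond_exp_noise_factor:
  fixes f :: "real^'d \<Rightarrow> real" and g :: "(real^'d^'d) \<times> (real^'d) \<Rightarrow> real" and i j :: 'd and t :: int
  assumes [measurable]: "f \<in> borel_measurable borel" and g: "g \<in> borel_measurable borel"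
    and bounds: "\<And>x. \<bar>f x\<bar> \<le> C" "\<And>x. \<bar>g x\<bar> \<le> C"
  defines "G \<equiv> past_algebra M (\<lambda>s \<omega>. W s \<omega> $ i) (\<lambda>s \<omega>. W s \<omega> $ j) t"
  shows "AE \<omega> in M. real_cond_exp M G (\<lambda>\<omega>. g (A (t + 1) \<omega>, B (t + 1) \<omega>) * f (W t \<omega>)) \<omega>
    = expectation (\<lambda>\<omega>. g (A (t + 1) \<omega>, B (t + 1) \<omega>)) * real_cond_exp M G (\<lambda>\<omega>. f (W t \<omega>)) \<omega>"
proof (rule real_cond_exp_indep_factor)
  show "subalgebra M G" unfolding G_def by (rule past_algebra_subalgebra)
  note [measurable] = measurable_compose[OF noise_measurable g]
  have C: "0 \<le> C" using bounds(1)[of 0] by simp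
  show int_f: "integrable M (\<lambda>\<omega>. f (W t \<omega>))"
    using bounds by (intro integrable_const_bound[where B = C]) auto
  show "integrable M (\<lambda>\<omega>. g (A (t + 1) \<omega>, B (t + 1) \<omega>) * f (W t \<omega>))"
    using bounds C by (intro integrable_const_bound[where B = "C * C"]) (auto simp: abs_mult intro!: mult_mono)
  fix D assume "D \<in> sets G"
  then obtain P where P [measurable]: "P \<in> sets (\<Pi>\<^sub>M s\<in>{..t}. borel)"
    and D: "\<And>\<omega>. \<omega> \<in> space M \<Longrightarrow> \<omega> \<in> D \<longleftrightarrow> (\<lambda>s\<in>{..t}. (W s \<omega> $ i, W s \<omega> $ j)) \<in> P"
    unfolding G_def by (rule past_algebra_set_cases) blast
  have DM [measurable]: "D \<in> sets M"
    using \<open>D \<in> sets G\<close> past_algebra_subalgebra[of i j t] by (auto simp: G_def subalgebra_def)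
  \<comment> \<open>This represents \<open>f (W t \<omega>) * indicator D \<omega>\<close> through
    the noise history, with every \<open>W s\<close> replaced by the series solution.\<close>
  define \<phi> where "\<phi> h = f (sre_solution t h) * indicator P (\<lambda>s\<in>{..t}. (sre_solution s h $ i, sre_solution s h $ j))" for h
  have [measurable]: "sre_solution s \<in> borel_measurable (\<Pi>\<^sub>M r\<in>{..t}. (borel :: ((real^'d^'d) \<times> (real^'d)) measure))"
    if "s \<le> t" for s
    using that by (rule sre_solution_measurable)
  have [measurable]: "(\<lambda>h. \<lambda>s\<in>{..t}. (sre_solution s h $ i, sre_solution s h $ j))
      \<in> measurable (\<Pi>\<^sub>M r\<in>{..t}. (borel :: ((real^'d^'d) \<times> (real^'d)) measure)) (\<Pi>\<^sub>M s\<in>{..t}. borel)"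
    by (intro measurable_restrict borel_measurable_Pair borel_measurable_vec_component) simp_all
  have \<phi> [measurable]: "\<phi> \<in> borel_measurable (\<Pi>\<^sub>M s\<in>{..t}. borel)"
    unfolding \<phi>_def by measurable
  note hm [measurable] = indep_pair_rv(1)[OF history_noise_indep[of t]]
  have eq: "AE \<omega> in M. f (W t \<omega>) * indicator D \<omega> = \<phi> (history t \<omega>)"
    using W_eq_solution[of t] AE_space
  proof eventually_elim
    case (elim \<omega>)
    then have "(\<lambda>s\<in>{..t}. (W s \<omega> $ i, W s \<omega> $ j))
        = (\<lambda>s\<in>{..t}. (sre_solution s (history t \<omega>) $ i, sre_solution s (history t \<omega>) $ j))"
      by (auto simp: restrict_def)
    with elim D[of \<omega>] show ?case by (simp add: \<phi>_def indicator_def)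
  qed
  have "expectation (\<lambda>\<omega>. g (A (t + 1) \<omega>, B (t + 1) \<omega>) * (f (W t \<omega>) * indicator D \<omega>))
      = expectation (\<lambda>\<omega>. \<phi> (history t \<omega>) * g (A (t + 1) \<omega>, B (t + 1) \<omega>))"
  proof (rule integral_cong_AE)
    show "AE \<omega> in M. g (A (t + 1) \<omega>, B (t + 1) \<omega>) * (f (W t \<omega>) * indicator D \<omega>)
      = \<phi> (history t \<omega>) * g (A (t + 1) \<omega>, B (t + 1) \<omega>)"
      using eq by eventually_elim simp
  qed measurable
  also have "\<dots> = expectation (\<lambda>\<omega>. \<phi> (history t \<omega>)) * expectation (\<lambda>\<omega>. g (A (t + 1) \<omega>, B (t + 1) \<omega>))"
  proof (rule expectation_indep_pair_mult[OF history_noise_indep \<phi> g])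
    show "integrable M (\<lambda>\<omega>. \<phi> (history t \<omega>))"
      using bounds C by (intro integrable_const_bound[where B = C]) (auto simp: \<phi>_def indicator_def)
    show "integrable M (\<lambda>\<omega>. g (A (t + 1) \<omega>, B (t + 1) \<omega>))"
      using bounds by (intro integrable_const_bound[where B = C]) auto
  qed
  also have "expectation (\<lambda>\<omega>. \<phi> (history t \<omega>)) = expectation (\<lambda>\<omega>. f (W t \<omega>) * indicator D \<omega>)"
    using eq by (intro integral_cong_AE) (auto elim: eventually_mono)
  finally show "expectation (\<lambda>\<omega>. g (A (t + 1) \<omega>, B (t + 1) \<omega>) * (f (W t \<omega>) * indicator D \<omega>))
    = expectation (\<lambda>\<omega>. g (A (t + 1) \<omega>, B (t + 1) \<omega>)) * expectation (\<lambda>\<omega>. f (W t \<omega>) * indicator D \<omega>)"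
    by (simp add: mult.commute)
qed

text \<open>Each term of the series applies a product of non-negative matrices to a non-negative
  vector.\<close>

lemma W_nonneg:
  assumes "\<And>t i. AE \<omega> in M. B t \<omega> $ i \<ge> 0" "\<And>t i j. AE \<omega> in M. A t \<omega> $ i $ j \<ge> 0"
  shows "AE \<omega> in M. 0 \<le> W t \<omega> $ i"
proof -
  have "AE \<omega> in M. \<forall>t i. B t \<omega> $ i \<ge> 0" "AE \<omega> in M. \<forall>t i j. A t \<omega> $ i $ j \<ge> 0"
    using assms by (simp_all add: AE_all_countable)
  with W_sums[of t] show ?thesis
  proof eventually_elim
    case (elim \<omega>)
    have W_i: "(\<lambda>k. (sre_prod (\<lambda>s. A s \<omega>) t k *v B (t - int k) \<omega>) $ i) sums (W t \<omega> $ i)"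
      by (rule bounded_linear.sums[OF bounded_linear_vec_nth elim(1)])
    show ?case
      by (rule sums_le[OF _ sums_zero W_i])
         (use elim in \<open>auto simp: matrix_vector_mult_def intro!: sum_nonneg mult_nonneg_nonneg sre_prod_nonneg\<close>)
  qed
qed

text \<open>Row \<open>k\<close> of the noise at time \<open>t\<close> is independent of
  \<open>G\<close>, even though \<open>G\<close> includes time \<open>t\<close> itself. Before
  \<open>t\<close> the coordinates \<open>i\<close> and \<open>j\<close> depend on older noise only,
  and at time \<open>t\<close> the recurrence brings in rows \<open>i\<close> and \<open>j\<close>
  but never row \<open>k\<close>.\<close>

lemma real_cond_exp_row:
  fixes g :: "(real^'d) \<times> real \<Rightarrow> real" and i j k :: 'd and t :: int
  assumes rows: "indep_vars (\<lambda>_. borel) (\<lambda>i \<omega>. (A t \<omega> $ i, B t \<omega> $ i)) UNIV"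
    and rec: "AE \<omega> in M. W t \<omega> = A t \<omega> *v W (t - 1) \<omega> + B t \<omega>"
    and ne: "i \<noteq> k" "j \<noteq> k"
    and g [measurable]: "g \<in> borel_measurable borel" and bound: "\<And>x. \<bar>g x\<bar> \<le> C"
  defines "G \<equiv> past_algebra M (\<lambda>s \<omega>. W s \<omega> $ i) (\<lambda>s \<omega>. W s \<omega> $ j) t"
  shows "AE \<omega> in M. real_cond_exp M G (\<lambda>\<omega>. g (A t \<omega> $ k, B t \<omega> $ k)) \<omega> = expectation (\<lambda>\<omega>. g (A t \<omega> $ k, B t \<omega> $ k))"
proof -
  define row where "row l n = (fst n $ l, snd n $ l)" for l :: 'd and n :: "(real^'d^'d) \<times> (real^'d)"
  define noise where "noise \<omega> = (A t \<omega>, B t \<omega>)" for \<omega>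
  define other where "other n = (\<lambda>l\<in>- {k}. row l n)" for n
  let ?R = "\<Pi>\<^sub>M l\<in>- {k}. (borel :: ((real^'d) \<times> real) measure)"
  let ?H = "\<Pi>\<^sub>M s\<in>{..t - 1}. (borel :: ((real^'d^'d) \<times> (real^'d)) measure)"
  have row [measurable]: "row l \<in> borel_measurable borel" for l
    unfolding row_def
    by (intro borel_measurable_Pair borel_measurable_vec_component) (simp_all add: borel_prod[symmetric])
  have other [measurable]: "other \<in> measurable borel ?R"
    unfolding other_def by (intro measurable_restrict row)
  have hist: "indep_pair ?H (history (t - 1)) borel noise"
    using history_noise_indep[of "t - 1"] by (simp add: noise_def[abs_def])
  have "indep_pair ?R (\<lambda>\<omega>. \<lambda>l\<in>- {k}. (A t \<omega> $ l, B t \<omega> $ l)) (\<Pi>\<^sub>M l\<in>{k}. borel) (\<lambda>\<omega>. \<lambda>l\<in>{k}. (A t \<omega> $ l, B t \<omega> $ l))"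
    unfolding indep_pair_indep_var by (rule indep_var_restrict[OF rows]) auto
  from indep_pair_compose[OF this, of "\<lambda>h. h" _ "\<lambda>h. h k" borel]
  have "indep_pair ?R (\<lambda>\<omega>. other (noise \<omega>)) borel (\<lambda>\<omega>. row k (noise \<omega>))"
    by (simp add: other_def row_def noise_def)
  from indep_pair_refine[OF hist other row this]
  have ind: "indep_pair (?H \<Otimes>\<^sub>M ?R) (\<lambda>\<omega>. (history (t - 1) \<omega>, other (noise \<omega>))) borel (\<lambda>\<omega>. row k (noise \<omega>))" .
  note [measurable] = indep_pair_rv[OF ind]
  have int_g: "integrable M (\<lambda>\<omega>. g (row k (noise \<omega>)))"
    using bound by (intro integrable_const_bound[where B = C]) auto
  \<comment> \<open>Taking the second factor to be constantly 1 reduces the claim to the factor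
    rule.\<close>
  have "AE \<omega> in M. real_cond_exp M G (\<lambda>\<omega>. g (row k (noise \<omega>)) * 1) \<omega>
      = expectation (\<lambda>\<omega>. g (row k (noise \<omega>))) * real_cond_exp M G (\<lambda>\<omega>. 1) \<omega>"
  proof (rule real_cond_exp_indep_factor)
    show "subalgebra M G" unfolding G_def by (rule past_algebra_subalgebra)
    show "integrable M (\<lambda>\<omega>. g (row k (noise \<omega>)) * 1)" using int_g by simp
    fix D assume "D \<in> sets G"
    then obtain P where P [measurable]: "P \<in> sets (\<Pi>\<^sub>M s\<in>{..t}. borel)"
      and D: "\<And>\<omega>. \<omega> \<in> space M \<Longrightarrow> \<omega> \<in> D \<longleftrightarrow> (\<lambda>s\<in>{..t}. (W s \<omega> $ i, W s \<omega> $ j)) \<in> P"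
      unfolding G_def by (rule past_algebra_set_cases) blast
    have [measurable]: "D \<in> sets M"
      using \<open>D \<in> sets G\<close> past_algebra_subalgebra[of i j t] by (auto simp: G_def subalgebra_def)
    \<comment> \<open>Time \<open>t\<close> is rebuilt from one step of the recurrence, reading only
      row \<open>l\<close> of the current noise; earlier times come from the series solution. For
      \<open>l \<noteq> k\<close> the result is thus a function of the pair that is independent of
      row \<open>k\<close>.\<close>
    define coord where "coord l s z = (if s = t then fst (snd z l) \<bullet> sre_solution (t - 1) (fst z) + snd (snd z l)
        else sre_solution s (fst z) $ l)" for l s and z :: "(int \<Rightarrow> (real^'d^'d) \<times> (real^'d)) \<times> ('d \<Rightarrow> (real^'d) \<times> real)"
    define \<phi> :: "_ \<Rightarrow> real" where "\<phi> z = indicator P (\<lambda>s\<in>{..t}. (coord i s z, coord j s z))" for z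
    have coord: "coord l s \<in> borel_measurable (?H \<Otimes>\<^sub>M ?R)" if "s \<le> t" "l \<noteq> k" for l s
    proof -
      have "(\<lambda>r. r l) \<in> measurable ?R borel"
        using that by (intro measurable_component_singleton) simp
      then have [measurable]: "(\<lambda>r. fst (r l)) \<in> borel_measurable ?R" "(\<lambda>r. snd (r l)) \<in> borel_measurable ?R"
        by (simp_all add: borel_prod[symmetric])
      have [measurable]: "sre_solution r \<in> borel_measurable ?H" if "r \<le> t - 1" for r
        using that by (rule sre_solution_measurable)
      show ?thesis
        using that unfolding coord_def by (cases "s = t") auto
    qed
    have [measurable]: "(\<lambda>z. \<lambda>s\<in>{..t}. (coord i s z, coord j s z)) \<in> measurable (?H \<Otimes>\<^sub>M ?R) (\<Pi>\<^sub>M s\<in>{..t}. borel)"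
      using ne by (intro measurable_restrict borel_measurable_Pair coord) auto
    have \<phi> [measurable]: "\<phi> \<in> borel_measurable (?H \<Otimes>\<^sub>M ?R)"
      unfolding \<phi>_def by measurable
    have eq: "AE \<omega> in M. indicator D \<omega> = \<phi> (history (t - 1) \<omega>, other (noise \<omega>))"
      using W_eq_solution[of "t - 1"] rec AE_space
    proof eventually_elim
      case (elim \<omega>)
      have "W s \<omega> $ l = coord l s (history (t - 1) \<omega>, other (noise \<omega>))" if "s \<le> t" "l \<noteq> k" for s l
        using that elim
        by (auto simp: coord_def other_def row_def noise_def matrix_vector_mul_component)
      then have "(\<lambda>s\<in>{..t}. (W s \<omega> $ i, W s \<omega> $ j)) = (\<lambda>s\<in>{..t}.
          (coord i s (history (t - 1) \<omega>, other (noise \<omega>)), coord j s (history (t - 1) \<omega>, other (noise \<omega>))))"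
        using ne by (auto simp: restrict_def)
      with elim D[of \<omega>] show ?case by (simp add: \<phi>_def indicator_def)
    qed
    have "expectation (\<lambda>\<omega>. g (row k (noise \<omega>)) * (1 * indicator D \<omega>))
        = expectation (\<lambda>\<omega>. \<phi> (history (t - 1) \<omega>, other (noise \<omega>)) * g (row k (noise \<omega>)))"
    proof (rule integral_cong_AE)
      show "AE \<omega> in M. g (row k (noise \<omega>)) * (1 * indicator D \<omega>)
        = \<phi> (history (t - 1) \<omega>, other (noise \<omega>)) * g (row k (noise \<omega>))"
        using eq by eventually_elim simp
    qed measurable
    also have "\<dots> = expectation (\<lambda>\<omega>. \<phi> (history (t - 1) \<omega>, other (noise \<omega>))) * expectation (\<lambda>\<omega>. g (row k (noise \<omega>)))"
    proof (rule expectation_indep_pair_mult[OF ind \<phi> g])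
      show "integrable M (\<lambda>\<omega>. \<phi> (history (t - 1) \<omega>, other (noise \<omega>)))"
        by (intro integrable_const_bound[where B = 1]) (auto simp: \<phi>_def indicator_def)
    qed (rule int_g)
    also have "expectation (\<lambda>\<omega>. \<phi> (history (t - 1) \<omega>, other (noise \<omega>))) = expectation (\<lambda>\<omega>. 1 * indicator D \<omega>)"
      using eq by (intro integral_cong_AE) (auto elim: eventually_mono)
    finally show "expectation (\<lambda>\<omega>. g (row k (noise \<omega>)) * (1 * indicator D \<omega>))
        = expectation (\<lambda>\<omega>. g (row k (noise \<omega>))) * expectation (\<lambda>\<omega>. 1 * indicator D \<omega>)"
      by (simp add: mult.commute)
  qed simp
  moreover have "AE \<omega> in M. real_cond_exp M G (\<lambda>\<omega>. 1) \<omega> = 1"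
  proof -
    interpret finite_measure_subalgebra M G
      unfolding G_def by unfold_locales (rule past_algebra_subalgebra)
    show ?thesis by (rule real_cond_exp_F_meas) auto
  qed
  ultimately show ?thesis
    by eventually_elim (simp add: row_def noise_def)
qed

text \<open>By non-negativity the recurrence gives
  \<open>W t \<omega> $ x \<ge> B t \<omega> $ x\<close>. The conditional probability that
  \<open>B t \<omega> $ x\<close> exceeds \<open>v\<close> is constant, by row independence, and
  positive by \<open>pos\<close>; it bounds the one in question from below.\<close>

lemma exceedance_cond_prob_pos:
  fixes x y z :: 'd and t :: int
  assumes nonneg: "\<And>t i. AE \<omega> in M. B t \<omega> $ i \<ge> 0" "\<And>t i j. AE \<omega> in M. A t \<omega> $ i $ j \<ge> 0"
    and rows: "indep_vars (\<lambda>_. borel) (\<lambda>i \<omega>. (A t \<omega> $ i, B t \<omega> $ i)) UNIV"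
    and rec: "AE \<omega> in M. W t \<omega> = A t \<omega> *v W (t - 1) \<omega> + B t \<omega>"
    and ne: "y \<noteq> x" "z \<noteq> x"
    and pos: "prob {\<omega>\<in>space M. v < B t \<omega> $ x} > 0"
  defines "G \<equiv> past_algebra M (\<lambda>s \<omega>. W s \<omega> $ y) (\<lambda>s \<omega>. W s \<omega> $ z) t"
  shows "AE \<omega> in M. 0 < real_cond_exp M G (indicator {\<omega>\<in>space M. v < W t \<omega> $ x}) \<omega>"
proof -
  interpret finite_measure_subalgebra M G
    unfolding G_def by unfold_locales (rule past_algebra_subalgebra)
  define b :: "(real^'d) \<times> real \<Rightarrow> real" where "b r = indicator {v<..} (snd r)" for r
  have b [measurable]: "b \<in> borel_measurable borel"
    unfolding b_def by (simp add: borel_prod[symmetric])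
  have b_rv [measurable]: "(\<lambda>\<omega>. b (A t \<omega> $ x, B t \<omega> $ x)) \<in> borel_measurable M"
    unfolding b_def by simp
  have b_exp: "AE \<omega> in M. real_cond_exp M G (\<lambda>\<omega>. b (A t \<omega> $ x, B t \<omega> $ x)) \<omega> = expectation (\<lambda>\<omega>. b (A t \<omega> $ x, B t \<omega> $ x))"
    unfolding G_def by (rule real_cond_exp_row[OF rows rec ne b, where C = 1]) (auto simp: b_def indicator_def)
  have b_prob: "expectation (\<lambda>\<omega>. b (A t \<omega> $ x, B t \<omega> $ x)) = prob {\<omega>\<in>space M. v < B t \<omega> $ x}"
  proof -
    have "expectation (\<lambda>\<omega>. b (A t \<omega> $ x, B t \<omega> $ x)) = expectation (indicator {\<omega>\<in>space M. v < B t \<omega> $ x})"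
      by (intro Bochner_Integration.integral_cong) (auto simp: b_def indicator_def)
    then show ?thesis by simp
  qed
  have "AE \<omega> in M. real_cond_exp M G (\<lambda>\<omega>. b (A t \<omega> $ x, B t \<omega> $ x)) \<omega>
      \<le> real_cond_exp M G (indicator {\<omega>\<in>space M. v < W t \<omega> $ x}) \<omega>"
  proof (rule real_cond_exp_mono)
    have "AE \<omega> in M. \<forall>j. A t \<omega> $ x $ j \<ge> 0" "AE \<omega> in M. \<forall>j. W (t - 1) \<omega> $ j \<ge> 0"
      using nonneg W_nonneg[OF nonneg, of "t - 1"] by (simp_all add: AE_all_countable)
    with rec AE_space show "AE \<omega> in M. b (A t \<omega> $ x, B t \<omega> $ x) \<le> indicator {\<omega>\<in>space M. v < W t \<omega> $ x} \<omega>"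
    proof eventually_elim
      case (elim \<omega>)
      have "0 \<le> (A t \<omega> *v W (t - 1) \<omega>) $ x"
        using elim by (auto simp: matrix_vector_mult_def intro!: sum_nonneg)
      with elim show ?case by (auto simp: b_def indicator_def)
    qed
    show "integrable M (\<lambda>\<omega>. b (A t \<omega> $ x, B t \<omega> $ x))"
      by (intro integrable_const_bound[where B = 1]) (auto simp: b_def indicator_def)
    show "integrable M (indicator {\<omega>\<in>space M. v < W t \<omega> $ x} :: _ \<Rightarrow> real)"
      by (intro integrable_const_bound[where B = 1]) (auto simp: indicator_def)
  qed
  with b_exp show ?thesis
    by eventually_elim (use pos b_prob in simp)
qed

section \<open>Concentration of averages over selected times\<close>

text \<open>On \<open>[0, 1]\<close> one has \<open>exp r \<le> 1 + 2 * r\<close>, so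
  \<open>u - 2 * \<mu>\<close> has exponential mean at most
  \<open>exp (- 2 * \<mu>) * (1 + 2 * \<mu>) \<le> 1\<close>. Because
  \<open>2 * \<mu> \<le> \<delta> / 2\<close>, a selected sum above \<open>\<delta>\<close> times
  the count leaves an excess of at least \<open>\<delta> / 2 * K\<close> after centring.\<close>

lemma selected_mean_small:
  fixes u :: "(real^'d^'d) \<times> (real^'d) \<Rightarrow> real" and R :: "real^'d \<Rightarrow> bool" and a b :: int
  assumes R: "Measurable.pred borel R" and u [measurable]: "u \<in> borel_measurable borel"
    and bounds: "\<And>n. 0 \<le> u n" "\<And>n. u n \<le> 1"
    and mean: "\<And>k. expectation (\<lambda>\<omega>. u (A k \<omega>, B k \<omega>)) \<le> \<mu>" and \<delta>: "0 < \<delta>" "4 * \<mu> \<le> \<delta>"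
  defines "S \<equiv> \<lambda>\<omega>. {k\<in>{a..b}. R (W k \<omega>)}"
  shows "prob {\<omega>\<in>space M. K < real (card (S \<omega>)) \<and>
      \<delta> * real (card (S \<omega>)) < (\<Sum>k\<in>S \<omega>. u (A (k + 1) \<omega>, B (k + 1) \<omega>))} \<le> exp (- (\<delta> / 2 * K))"
proof -
  note [measurable] = measurable_compose[OF noise_measurable u] R
  have int: "integrable M (\<lambda>\<omega>. u (A k \<omega>, B k \<omega>))" for k
    using bounds by (intro integrable_const_bound[where B = 1]) auto
  have "0 \<le> expectation (\<lambda>\<omega>. u (A k \<omega>, B k \<omega>))" for k
    using bounds by (intro integral_nonneg_AE) simp
  then have "0 \<le> \<mu>" using mean order_trans by blast
  have "(\<integral>\<^sup>+\<omega>. ennreal (exp (u (A k \<omega>, B k \<omega>) - 2 * \<mu>)) \<partial>M) \<le> 1" for k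
  proof -
    have "(\<integral>\<^sup>+\<omega>. ennreal (exp (u (A k \<omega>, B k \<omega>) - 2 * \<mu>)) \<partial>M)
        \<le> (\<integral>\<^sup>+\<omega>. ennreal (exp (- 2 * \<mu>) * (1 + 2 * u (A k \<omega>, B k \<omega>))) \<partial>M)"
    proof (intro nn_integral_mono ennreal_leI)
      fix \<omega>
      define r where "r = u (A k \<omega>, B k \<omega>)"
      have r: "0 \<le> r" "r \<le> 1" using bounds by (simp_all add: r_def)
      have "exp r \<le> 1 + r + r\<^sup>2" by (rule exp_bound[OF r])
      also have "r\<^sup>2 \<le> r" using r by (simp add: power2_eq_square mult_left_le)
      finally have "exp r \<le> 1 + 2 * r" by simp
      then have "exp (- 2 * \<mu>) * exp r \<le> exp (- 2 * \<mu>) * (1 + 2 * r)" by simp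
      then show "exp (u (A k \<omega>, B k \<omega>) - 2 * \<mu>) \<le> exp (- 2 * \<mu>) * (1 + 2 * u (A k \<omega>, B k \<omega>))"
        by (simp add: r_def exp_diff exp_minus field_simps)
    qed
    also have "\<dots> = ennreal (expectation (\<lambda>\<omega>. exp (- 2 * \<mu>) * (1 + 2 * u (A k \<omega>, B k \<omega>))))"
      using bounds int by (intro nn_integral_eq_integral) auto
    also have "expectation (\<lambda>\<omega>. exp (- 2 * \<mu>) * (1 + 2 * u (A k \<omega>, B k \<omega>)))
        = exp (- 2 * \<mu>) * (1 + 2 * expectation (\<lambda>\<omega>. u (A k \<omega>, B k \<omega>)))"
      using int by (simp add: prob_space)
    also have "\<dots> \<le> exp (- 2 * \<mu>) * exp (2 * \<mu>)"
      by (intro mult_left_mono) (use mean[of k] exp_ge_add_one_self[of "2 * \<mu>"] in linarith, simp)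
    also have "\<dots> = 1" by (simp add: exp_minus)
    finally show ?thesis by (simp add: ennreal_leI)
  qed
  note tail = selected_sum_tail[OF R, of "\<lambda>n. u n - 2 * \<mu>", OF _ this]
  have "prob {\<omega>\<in>space M. \<delta> / 2 * K \<le> (\<Sum>k\<in>S \<omega>. u (A (k + 1) \<omega>, B (k + 1) \<omega>) - 2 * \<mu>)} \<le> exp (- (\<delta> / 2 * K))"
    unfolding S_def by (rule tail) measurable
  moreover have "prob {\<omega>\<in>space M. K < real (card (S \<omega>)) \<and> \<delta> * real (card (S \<omega>)) < (\<Sum>k\<in>S \<omega>. u (A (k + 1) \<omega>, B (k + 1) \<omega>))}
      \<le> prob {\<omega>\<in>space M. \<delta> / 2 * K \<le> (\<Sum>k\<in>S \<omega>. u (A (k + 1) \<omega>, B (k + 1) \<omega>) - 2 * \<mu>)}"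
  proof (rule finite_measure_mono)
    show "{\<omega>\<in>space M. \<delta> / 2 * K \<le> (\<Sum>k\<in>S \<omega>. u (A (k + 1) \<omega>, B (k + 1) \<omega>) - 2 * \<mu>)} \<in> sets M"
      unfolding S_def sum.inter_filter[OF finite_atLeastAtMost_int] by measurable
    have *: "\<delta> / 2 * K \<le> s - 2 * \<mu> * c" if "K < c" "\<delta> * c < s" "0 \<le> c" for s c :: real
    proof -
      have "2 * \<mu> * c \<le> \<delta> / 2 * c" using \<delta> that by (intro mult_right_mono) auto
      moreover have "\<delta> / 2 * K \<le> \<delta> / 2 * c" using \<delta> that by (intro mult_left_mono) auto
      ultimately show ?thesis using that by simp
    qed
    show "{\<omega>\<in>space M. K < real (card (S \<omega>)) \<and> \<delta> * real (card (S \<omega>)) < (\<Sum>k\<in>S \<omega>. u (A (k + 1) \<omega>, B (k + 1) \<omega>))}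
      \<subseteq> {\<omega>\<in>space M. \<delta> / 2 * K \<le> (\<Sum>k\<in>S \<omega>. u (A (k + 1) \<omega>, B (k + 1) \<omega>) - 2 * \<mu>)}"
    proof safe
      fix \<omega> assume "K < real (card (S \<omega>))" "\<delta> * real (card (S \<omega>)) < (\<Sum>k\<in>S \<omega>. u (A (k + 1) \<omega>, B (k + 1) \<omega>))"
      from *[OF this]
      show "\<delta> / 2 * K \<le> (\<Sum>k\<in>S \<omega>. u (A (k + 1) \<omega>, B (k + 1) \<omega>) - 2 * \<mu>)"
        by (simp add: sum_subtractf mult_ac)
    qed
  qed
  ultimately show ?thesis by simp
qed

text \<open>The mirror image: \<open>exp (- r) \<le> 1 - r / 2\<close> on \<open>[0, 1]\<close>
  gives \<open>p / 2 - u\<close> exponential mean at most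
  \<open>exp (p / 2) * (1 - p / 2) \<le> 1\<close>. A selected sum of at most \<open>p / 4\<close>
  times the count then leaves a deficit of at least \<open>p / 4 * K\<close>.\<close>

lemma selected_mean_large:
  fixes u :: "(real^'d^'d) \<times> (real^'d) \<Rightarrow> real" and R :: "real^'d \<Rightarrow> bool" and a b :: int
  assumes R: "Measurable.pred borel R" and u [measurable]: "u \<in> borel_measurable borel"
    and bounds: "\<And>n. 0 \<le> u n" "\<And>n. u n \<le> 1"
    and mean: "\<And>k. p \<le> expectation (\<lambda>\<omega>. u (A k \<omega>, B k \<omega>))" and p: "0 \<le> p"
  defines "S \<equiv> \<lambda>\<omega>. {k\<in>{a..b}. R (W k \<omega>)}"
  shows "prob {\<omega>\<in>space M. K < real (card (S \<omega>)) \<and>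
      (\<Sum>k\<in>S \<omega>. u (A (k + 1) \<omega>, B (k + 1) \<omega>)) \<le> p / 4 * real (card (S \<omega>))} \<le> exp (- (p / 4 * K))"
proof -
  note [measurable] = measurable_compose[OF noise_measurable u] R
  have int: "integrable M (\<lambda>\<omega>. u (A k \<omega>, B k \<omega>))" for k
    using bounds by (intro integrable_const_bound[where B = 1]) auto
  have "(\<integral>\<^sup>+\<omega>. ennreal (exp (p / 2 - u (A k \<omega>, B k \<omega>))) \<partial>M) \<le> 1" for k
  proof -
    have "(\<integral>\<^sup>+\<omega>. ennreal (exp (p / 2 - u (A k \<omega>, B k \<omega>))) \<partial>M)
        \<le> (\<integral>\<^sup>+\<omega>. ennreal (exp (p / 2) * (1 - u (A k \<omega>, B k \<omega>) / 2)) \<partial>M)"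
    proof (intro nn_integral_mono ennreal_leI)
      fix \<omega>
      define r where "r = u (A k \<omega>, B k \<omega>)"
      have r: "0 \<le> r" "r \<le> 1" using bounds by (simp_all add: r_def)
      have "0 \<le> r * (1 - r)" using r by simp
      \<comment> \<open>The right-hand side equals \<open>1 + r * (1 - r) / 2\<close>.\<close>
      then have "1 \<le> (1 - r / 2) * (1 + r)" by (simp add: algebra_simps)
      also have "\<dots> \<le> (1 - r / 2) * exp r"
        using r exp_ge_add_one_self[of r] by (intro mult_left_mono) auto
      finally have "exp (- r) \<le> 1 - r / 2" by (simp add: exp_minus field_simps)
      then have "exp (p / 2) * exp (- r) \<le> exp (p / 2) * (1 - r / 2)" by simp
      then show "exp (p / 2 - u (A k \<omega>, B k \<omega>)) \<le> exp (p / 2) * (1 - u (A k \<omega>, B k \<omega>) / 2)"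
        unfolding r_def exp_add[symmetric] by simp
    qed
    also have "\<dots> = ennreal (expectation (\<lambda>\<omega>. exp (p / 2) * (1 - u (A k \<omega>, B k \<omega>) / 2)))"
      using bounds int by (intro nn_integral_eq_integral) (auto intro!: AE_I2 mult_nonneg_nonneg order_trans[OF bounds(2)])
    also have "expectation (\<lambda>\<omega>. exp (p / 2) * (1 - u (A k \<omega>, B k \<omega>) / 2))
        = exp (p / 2) * (1 - expectation (\<lambda>\<omega>. u (A k \<omega>, B k \<omega>)) / 2)"
      using int by (simp add: prob_space)
    also have "\<dots> \<le> exp (p / 2) * exp (- (p / 2))"
      using mean[of k] exp_ge_add_one_self[of "- (p / 2)"] by (intro mult_left_mono) auto
    also have "\<dots> = 1" by (simp add: exp_minus)
    finally show ?thesis by (simp add: ennreal_leI)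
  qed
  note tail = selected_sum_tail[OF R, of "\<lambda>n. p / 2 - u n", OF _ this]
  have "prob {\<omega>\<in>space M. p / 4 * K \<le> (\<Sum>k\<in>S \<omega>. p / 2 - u (A (k + 1) \<omega>, B (k + 1) \<omega>))} \<le> exp (- (p / 4 * K))"
    unfolding S_def by (rule tail) measurable
  moreover have "prob {\<omega>\<in>space M. K < real (card (S \<omega>)) \<and> (\<Sum>k\<in>S \<omega>. u (A (k + 1) \<omega>, B (k + 1) \<omega>)) \<le> p / 4 * real (card (S \<omega>))}
      \<le> prob {\<omega>\<in>space M. p / 4 * K \<le> (\<Sum>k\<in>S \<omega>. p / 2 - u (A (k + 1) \<omega>, B (k + 1) \<omega>))}"
  proof (rule finite_measure_mono)
    show "{\<omega>\<in>space M. p / 4 * K \<le> (\<Sum>k\<in>S \<omega>. p / 2 - u (A (k + 1) \<omega>, B (k + 1) \<omega>))} \<in> sets M"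
      unfolding S_def sum.inter_filter[OF finite_atLeastAtMost_int] by measurable
    have *: "p / 4 * K \<le> c * (p / 2) - s" if "K < c" "s \<le> p / 4 * c" for s c :: real
      using mult_left_mono[of K c "p / 4"] that p by (simp add: mult.commute)
    show "{\<omega>\<in>space M. K < real (card (S \<omega>)) \<and> (\<Sum>k\<in>S \<omega>. u (A (k + 1) \<omega>, B (k + 1) \<omega>)) \<le> p / 4 * real (card (S \<omega>))}
      \<subseteq> {\<omega>\<in>space M. p / 4 * K \<le> (\<Sum>k\<in>S \<omega>. p / 2 - u (A (k + 1) \<omega>, B (k + 1) \<omega>))}"
    proof safe
      fix \<omega> assume "K < real (card (S \<omega>))" "(\<Sum>k\<in>S \<omega>. u (A (k + 1) \<omega>, B (k + 1) \<omega>)) \<le> p / 4 * real (card (S \<omega>))"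
      from *[OF this] show "p / 4 * K \<le> (\<Sum>k\<in>S \<omega>. p / 2 - u (A (k + 1) \<omega>, B (k + 1) \<omega>))"
        by (simp add: sum_subtractf)
    qed
  qed
  ultimately show ?thesis by simp
qed

end

subsection \<open>The causal tail coefficient\<close>

text \<open>Natural numbers are rational and unbounded. Without this, limits along the filter would
  not be unique and \<open>Lim\<close> would carry no information.\<close>

lemma threshold_at_top_neq_bot: "threshold_at_top \<noteq> bot"
proof -
  have "\<exists>\<^sub>F v in at_top. v \<in> (\<rat> :: real set)"
    unfolding frequently_def eventually_at_top_linorder
    by (metis Rats_of_nat real_arch_simple)
  then show ?thesis
    by (simp add: trivial_limit_def eventually_inf_principal frequently_def)
qed

lemma eventually_threshold_at_top:
  "(\<forall>\<^sub>F v in threshold_at_top. P v) \<longleftrightarrow> (\<forall>\<^sub>F v in at_top. v \<in> \<rat> \<longrightarrow> P v)"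
  by (simp add: eventually_inf_principal)

text \<open>Dominated convergence with the constant bound 1: where \<open>a \<omega> > 0\<close>,
  the argument \<open>a \<omega> * v\<close> tends to infinity.\<close>

lemma tendsto_expectation_cdf_mult:
  fixes N :: "real measure" and a :: "'a \<Rightarrow> real"
  assumes "prob_space M" "real_distribution N" and [measurable]: "a \<in> borel_measurable M"
    and pos: "AE \<omega> in M. 0 < a \<omega>"
  shows "((\<lambda>v. \<integral>\<omega>. cdf N (a \<omega> * v) \<partial>M) \<longlongrightarrow> 1) at_top"
proof -
  interpret prob_space M by fact
  interpret N: real_distribution N by fact
  have [measurable]: "cdf N \<in> borel_measurable borel"
    by (intro borel_measurable_mono monoI N.cdf_nondecreasing)
  have "((\<lambda>v. \<integral>\<omega>. cdf N (a \<omega> * v) \<partial>M) \<longlongrightarrow> (\<integral>\<omega>. 1 \<partial>M)) at_top"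
  proof (rule integral_dominated_convergence_at_top[where w = "\<lambda>_. 1"])
    show "AE \<omega> in M. ((\<lambda>v. cdf N (a \<omega> * v)) \<longlongrightarrow> 1) at_top"
      using pos
    proof eventually_elim
      case (elim \<omega>)
      then have "filterlim (\<lambda>v. a \<omega> * v) at_top at_top"
        by (intro filterlim_tendsto_pos_mult_at_top[OF tendsto_const] filterlim_ident)
      then show ?case
        by (rule filterlim_compose[OF N.cdf_lim_at_top_prob])
    qed
    show "\<forall>\<^sub>F v in at_top. AE \<omega> in M. norm (cdf N (a \<omega> * v)) \<le> 1"
      using N.cdf_nonneg N.cdf_bounded_prob by simp
  qed (auto simp: finite_measure_def)
  then show ?thesis by (simp add: prob_space)
qed

text \<open>The three coordinates keep symbolic names in an arbitrary index type. Row independence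
  and the sign of the coefficient of \<open>X t\<close> are assumed lemma by lemma, since the two
  cases need different facts.\<close>

locale tail_sre = stationary_sre M A B W for M :: "'a measure" and A :: "int \<Rightarrow> 'a \<Rightarrow> real^'d^'d" and B W +
  fixes x y z :: 'd and N :: "real measure" and F :: "real \<Rightarrow> real"
  assumes coordinates: "UNIV = {x, y, z}" "x \<noteq> y" "x \<noteq> z" "y \<noteq> z"
    and ident_distr: "\<And>s t. distr M borel (\<lambda>\<omega>. (A s \<omega>, B s \<omega>)) = distr M borel (\<lambda>\<omega>. (A t \<omega>, B t \<omega>))"
    and B_nonneg: "\<And>t i. AE \<omega> in M. B t \<omega> $ i \<ge> 0"
    and A_nonneg: "\<And>t i j. AE \<omega> in M. A t \<omega> $ i $ j \<ge> 0"
    and recurrence: "\<And>t. AE \<omega> in M. W t \<omega> = A t \<omega> *v W (t - 1) \<omega> + B t \<omega>"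
    and F_distribution: "real_distribution N" "F = cdf N"
begin

abbreviation X where "X \<equiv> \<lambda>s \<omega>. W s \<omega> $ x"
abbreviation Y where "Y \<equiv> \<lambda>s \<omega>. W s \<omega> $ y"
abbreviation Z where "Z \<equiv> \<lambda>s \<omega>. W s \<omega> $ z"

lemma F_mono: "r \<le> s \<Longrightarrow> F r \<le> F s" and F_nonneg: "0 \<le> F r" and F_le_1: "F r \<le> 1"
  and F_measurable [measurable]: "F \<in> borel_measurable borel"
proof -
  interpret N: real_distribution N by (rule F_distribution)
  show "r \<le> s \<Longrightarrow> F r \<le> F s" "0 \<le> F r" "F r \<le> 1"
    by (simp_all add: F_distribution(2) N.cdf_nondecreasing N.cdf_nonneg N.cdf_bounded_prob)
  show "F \<in> borel_measurable borel"
    unfolding F_distribution(2) by (intro borel_measurable_mono monoI N.cdf_nondecreasing)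
qed

lemma expectation_noise_eq:
  fixes g :: "(real^'d^'d) \<times> (real^'d) \<Rightarrow> real"
  assumes g: "g \<in> borel_measurable borel"
  shows "expectation (\<lambda>\<omega>. g (A s \<omega>, B s \<omega>)) = expectation (\<lambda>\<omega>. g (A t \<omega>, B t \<omega>))"
  using integral_distr[OF noise_measurable[of s] g] integral_distr[OF noise_measurable[of t] g]
  by (simp add: ident_distr[of s t])

lemma prob_noise_eq:
  assumes P: "Measurable.pred borel P"
  shows "prob {\<omega>\<in>space M. P (A s \<omega>, B s \<omega>)} = prob {\<omega>\<in>space M. P (A t \<omega>, B t \<omega>)}"
proof -
  have "{n. P n} \<in> sets borel" using P by (simp add: pred_def)
  then have "measure (distr M borel (\<lambda>\<omega>. (A k \<omega>, B k \<omega>))) {n. P n} = prob {\<omega>\<in>space M. P (A k \<omega>, B k \<omega>)}" for k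
    by (subst measure_distr[OF noise_measurable]) (auto intro!: arg_cong[where f = prob])
  from this[of s] this[of t] show ?thesis by (simp add: ident_distr[of s t])
qed

lemma nonneg_all: "AE \<omega> in M. \<forall>t i. 0 \<le> W t \<omega> $ i \<and> 0 \<le> B t \<omega> $ i \<and> (\<forall>j. 0 \<le> A t \<omega> $ i $ j)"
  using W_nonneg[OF B_nonneg A_nonneg] B_nonneg A_nonneg by (simp add: AE_all_countable AE_conj_iff)

lemma Y_step: "AE \<omega> in M. \<forall>t. Y (t + 1) \<omega> =
    A (t + 1) \<omega> $ y $ x * X t \<omega> + A (t + 1) \<omega> $ y $ y * Y t \<omega> + A (t + 1) \<omega> $ y $ z * Z t \<omega> + B (t + 1) \<omega> $ y"
proof -
  have "AE \<omega> in M. \<forall>t. W t \<omega> = A t \<omega> *v W (t - 1) \<omega> + B t \<omega>"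
    using recurrence by (simp add: AE_all_countable)
  then show ?thesis
  proof (eventually_elim, intro allI)
    fix \<omega> t assume *: "\<forall>t. W t \<omega> = A t \<omega> *v W (t - 1) \<omega> + B t \<omega>"
    have "W (t + 1) \<omega> $ y = (A (t + 1) \<omega> *v W t \<omega>) $ y + B (t + 1) \<omega> $ y"
      by (subst *[rule_format, of "t + 1"]) simp
    also have "(A (t + 1) \<omega> *v W t \<omega>) $ y = (\<Sum>j\<in>{x, y, z}. A (t + 1) \<omega> $ y $ j * W t \<omega> $ j)"
      by (simp add: matrix_vector_mult_def coordinates(1)[symmetric])
    finally show "Y (t + 1) \<omega> =
      A (t + 1) \<omega> $ y $ x * X t \<omega> + A (t + 1) \<omega> $ y $ y * Y t \<omega> + A (t + 1) \<omega> $ y $ z * Z t \<omega> + B (t + 1) \<omega> $ y"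
      using coordinates(2-4) by (simp add: add.assoc)
  qed
qed

text \<open>A lower bound for \<open>F (Y (t + 1) \<omega>)\<close> on
  \<open>X t \<omega> \<ge> v\<close> that depends on the noise at \<open>t + 1\<close> alone: the
  other terms of the recurrence are non-negative and dropped.\<close>

definition lower_noise :: "real \<Rightarrow> (real^'d^'d) \<times> (real^'d) \<Rightarrow> real" where
  "lower_noise v n = F (fst n $ y $ x * v)"

text \<open>The matching upper bound on \<open>Y t \<omega> \<le> c\<close>,
  \<open>Z t \<omega> \<le> c\<close> when the coefficient of \<open>X t\<close> vanishes; one
  constant \<open>c\<close> serves for both coordinates.\<close>

definition upper_noise :: "real \<Rightarrow> (real^'d^'d) \<times> (real^'d) \<Rightarrow> real" where
  "upper_noise c n = F ((fst n $ y $ y + fst n $ y $ z) * c + snd n $ y)"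

lemma noise_component_measurable [measurable]:
  "(\<lambda>n::(real^'d^'d) \<times> (real^'d). fst n $ i $ j) \<in> borel_measurable borel"
  "(\<lambda>n::(real^'d^'d) \<times> (real^'d). snd n $ i) \<in> borel_measurable borel"
  by (intro borel_measurable_vec_component; simp add: borel_prod[symmetric])+

lemma lower_noise_measurable [measurable]: "lower_noise v \<in> borel_measurable borel"
  and upper_noise_measurable [measurable]: "upper_noise v \<in> borel_measurable borel"
  unfolding lower_noise_def upper_noise_def by measurable

text \<open>Once the signs and the recurrence hold at all times the inequality is deterministic, so
  a single null set covers all times and all real \<open>v\<close>.\<close>

lemma F_Y_lower: "AE \<omega> in M. \<forall>t v. 0 \<le> v \<longrightarrow> v \<le> X t \<omega> \<longrightarrow>
    lower_noise v (A (t + 1) \<omega>, B (t + 1) \<omega>) \<le> F (Y (t + 1) \<omega>)"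
  using nonneg_all Y_step
proof (eventually_elim, safe)
  fix \<omega> t v
  assume *: "\<forall>t i. 0 \<le> W t \<omega> $ i \<and> 0 \<le> B t \<omega> $ i \<and> (\<forall>j. 0 \<le> A t \<omega> $ i $ j)"
    "\<forall>t. Y (t + 1) \<omega> = A (t + 1) \<omega> $ y $ x * X t \<omega> + A (t + 1) \<omega> $ y $ y * Y t \<omega>
      + A (t + 1) \<omega> $ y $ z * Z t \<omega> + B (t + 1) \<omega> $ y" "v \<le> X t \<omega>"
  have "A (t + 1) \<omega> $ y $ x * v \<le> A (t + 1) \<omega> $ y $ x * X t \<omega>"
    "0 \<le> A (t + 1) \<omega> $ y $ y * Y t \<omega>" "0 \<le> A (t + 1) \<omega> $ y $ z * Z t \<omega>"
    using * by (auto intro: mult_left_mono)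
  then show "lower_noise v (A (t + 1) \<omega>, B (t + 1) \<omega>) \<le> F (Y (t + 1) \<omega>)"
    using * by (auto simp: lower_noise_def intro!: F_mono add_increasing2)
qed

lemma F_Y_upper:
  assumes zero: "\<And>t. AE \<omega> in M. A t \<omega> $ y $ x = 0"
  shows "AE \<omega> in M. \<forall>t c. Y t \<omega> \<le> c \<longrightarrow> Z t \<omega> \<le> c \<longrightarrow>
    F (Y (t + 1) \<omega>) \<le> upper_noise c (A (t + 1) \<omega>, B (t + 1) \<omega>)"
proof -
  have "AE \<omega> in M. \<forall>t. A t \<omega> $ y $ x = 0" using zero by (simp add: AE_all_countable)
  with nonneg_all Y_step show ?thesis
  proof (eventually_elim, safe)
    fix \<omega> t c
    assume *: "\<forall>t i. 0 \<le> W t \<omega> $ i \<and> 0 \<le> B t \<omega> $ i \<and> (\<forall>j. 0 \<le> A t \<omega> $ i $ j)"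
      "\<forall>t. Y (t + 1) \<omega> = A (t + 1) \<omega> $ y $ x * X t \<omega> + A (t + 1) \<omega> $ y $ y * Y t \<omega>
        + A (t + 1) \<omega> $ y $ z * Z t \<omega> + B (t + 1) \<omega> $ y"
      "\<forall>t. A t \<omega> $ y $ x = 0" "Y t \<omega> \<le> c" "Z t \<omega> \<le> c"
    have "A (t + 1) \<omega> $ y $ y * Y t \<omega> \<le> A (t + 1) \<omega> $ y $ y * c"
      "A (t + 1) \<omega> $ y $ z * Z t \<omega> \<le> A (t + 1) \<omega> $ y $ z * c"
      using * by (auto intro: mult_left_mono)
    then show "F (Y (t + 1) \<omega>) \<le> upper_noise c (A (t + 1) \<omega>, B (t + 1) \<omega>)"
      using * by (auto simp: upper_noise_def distrib_right intro!: F_mono)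
  qed
qed

section \<open>Bounds on the conditional expectation at a fixed threshold\<close>

text \<open>On the exceedance event \<open>F (Y (t + 1) \<omega>)\<close> lies between
  \<open>lower_noise v\<close> and 1. The mean of \<open>lower_noise v\<close> factors out of the
  conditional expectation, and dividing by the conditional probability of the event is legitimate
  because that probability is almost surely positive.\<close>

lemma tail_cond_exp_bounds:
  assumes rows: "indep_vars (\<lambda>_. borel) (\<lambda>i \<omega>. (A t \<omega> $ i, B t \<omega> $ i)) UNIV"
    and tail: "prob {\<omega>\<in>space M. v < B t \<omega> $ x} > 0" and "0 \<le> v"
  shows "AE \<omega> in M. expectation (\<lambda>\<omega>. lower_noise v (A (t + 1) \<omega>, B (t + 1) \<omega>)) \<le> tail_cond_exp M F X Y Z t \<omega> v
    \<and> tail_cond_exp M F X Y Z t \<omega> v \<le> 1"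
proof -
  define G where "G = past_algebra M Y Z t"
  interpret finite_measure_subalgebra M G
    unfolding G_def by unfold_locales (rule past_algebra_subalgebra)
  define E where "E = {\<omega>\<in>space M. v < X t \<omega>}"
  have [measurable]: "E \<in> sets M" unfolding E_def by measurable
  note [measurable] = measurable_compose[OF noise_measurable lower_noise_measurable]
  have bounds: "\<bar>lower_noise v n\<bar> \<le> 1" for n
    using F_nonneg F_le_1 by (simp add: lower_noise_def)
  have F_abs: "\<bar>F r\<bar> \<le> 1" for r using F_nonneg[of r] F_le_1[of r] by simp
  define f :: "real^'d \<Rightarrow> real" where "f w = indicator {v<..} (w $ x)" for w
  have [measurable]: "f \<in> borel_measurable borel" unfolding f_def by measurable
  have ind_f: "indicator E \<omega> = f (W t \<omega>)" if "\<omega> \<in> space M" for \<omega>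
    using that by (simp add: E_def f_def indicator_def)
  have "AE \<omega> in M. 0 < real_cond_exp M G (indicator E) \<omega>"
    unfolding G_def E_def
    by (rule exceedance_cond_prob_pos[OF B_nonneg A_nonneg rows recurrence _ _ tail]) (use coordinates in auto)
  moreover have "AE \<omega> in M. real_cond_exp M G (\<lambda>\<omega>. lower_noise v (A (t + 1) \<omega>, B (t + 1) \<omega>) * f (W t \<omega>)) \<omega>
      = expectation (\<lambda>\<omega>. lower_noise v (A (t + 1) \<omega>, B (t + 1) \<omega>)) * real_cond_exp M G (\<lambda>\<omega>. f (W t \<omega>)) \<omega>"
    unfolding G_def
    by (rule real_cond_exp_noise_factor[where C = 1]) (auto simp: f_def indicator_def bounds)
  moreover have "AE \<omega> in M. real_cond_exp M G (\<lambda>\<omega>. f (W t \<omega>)) \<omega> = real_cond_exp M G (indicator E) \<omega>"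
    by (rule real_cond_exp_cong) (auto simp: ind_f)
  moreover have "AE \<omega> in M. real_cond_exp M G (\<lambda>\<omega>. lower_noise v (A (t + 1) \<omega>, B (t + 1) \<omega>) * f (W t \<omega>)) \<omega>
      \<le> real_cond_exp M G (\<lambda>\<omega>. F (Y (t + 1) \<omega>) * indicator E \<omega>) \<omega>"
  proof (rule real_cond_exp_mono)
    show "AE \<omega> in M. lower_noise v (A (t + 1) \<omega>, B (t + 1) \<omega>) * f (W t \<omega>) \<le> F (Y (t + 1) \<omega>) * indicator E \<omega>"
      using F_Y_lower AE_space
      by eventually_elim (use \<open>0 \<le> v\<close> in \<open>auto simp: E_def f_def indicator_def F_nonneg\<close>)
    show "integrable M (\<lambda>\<omega>. lower_noise v (A (t + 1) \<omega>, B (t + 1) \<omega>) * f (W t \<omega>))"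
      "integrable M (\<lambda>\<omega>. F (Y (t + 1) \<omega>) * indicator E \<omega>)"
      by (auto intro!: integrable_const_bound[where B = 1] simp: f_def indicator_def bounds F_abs)
  qed
  moreover have "AE \<omega> in M. real_cond_exp M G (\<lambda>\<omega>. F (Y (t + 1) \<omega>) * indicator E \<omega>) \<omega>
      \<le> real_cond_exp M G (indicator E) \<omega>"
  proof (rule real_cond_exp_mono)
    show "AE \<omega> in M. F (Y (t + 1) \<omega>) * indicator E \<omega> \<le> indicator E \<omega>"
      by (auto simp: indicator_def F_le_1)
    show "integrable M (\<lambda>\<omega>. F (Y (t + 1) \<omega>) * indicator E \<omega>)" "integrable M (indicator E :: _ \<Rightarrow> real)"
      by (auto intro!: integrable_const_bound[where B = 1] simp: indicator_def F_abs)
  qed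
  ultimately show ?thesis
    unfolding tail_cond_exp_def cond_exp_event_def G_def[symmetric] E_def[symmetric]
    by eventually_elim (simp add: divide_simps)
qed

text \<open>The event \<open>D\<close> that \<open>Y t\<close> and \<open>Z t\<close> are at most
  \<open>c\<close> belongs to \<open>G\<close>, so its indicator may be moved through the
  conditional expectation. Inside, \<open>upper_noise c\<close> dominates and its mean factors out;
  restricting to \<open>D\<close> afterwards gives the bound there.\<close>

lemma tail_cond_exp_le:
  assumes zero: "\<And>t. AE \<omega> in M. A t \<omega> $ y $ x = 0"
  shows "AE \<omega> in M. Y t \<omega> \<le> c \<longrightarrow> Z t \<omega> \<le> c \<longrightarrow>
    tail_cond_exp M F X Y Z t \<omega> v \<le> expectation (\<lambda>\<omega>. upper_noise c (A (t + 1) \<omega>, B (t + 1) \<omega>))"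
proof -
  define G where "G = past_algebra M Y Z t"
  interpret finite_measure_subalgebra M G
    unfolding G_def by unfold_locales (rule past_algebra_subalgebra)
  define E where "E = {\<omega>\<in>space M. v < X t \<omega>}"
  define D where "D = {\<omega>\<in>space M. Y t \<omega> \<le> c \<and> Z t \<omega> \<le> c}"
  have [measurable]: "E \<in> sets M" "D \<in> sets M" unfolding E_def D_def by measurable
  have D [measurable]: "D \<in> sets G"
  proof -
    have "(\<lambda>\<omega>. \<lambda>s\<in>{..t}. (Y s \<omega>, Z s \<omega>)) \<in> measurable G (\<Pi>\<^sub>M s\<in>{..t}. borel)"
      unfolding G_def past_algebra_def by (rule measurable_vimage_algebra1) (auto simp: space_PiM)
    from measurable_compose[OF this measurable_component_singleton[of t]]
    have "(\<lambda>\<omega>. (Y t \<omega>, Z t \<omega>)) \<in> borel_measurable G" by simp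
    then have [measurable]: "Y t \<in> borel_measurable G" "Z t \<in> borel_measurable G"
      by (simp_all add: borel_prod[symmetric] measurable_pair_iff comp_def)
    have "D = {\<omega>\<in>space G. Y t \<omega> \<le> c \<and> Z t \<omega> \<le> c}"
      by (simp add: D_def G_def past_algebra_def)
    also have "\<dots> \<in> sets G" by measurable
    finally show ?thesis .
  qed
  note [measurable] = measurable_compose[OF noise_measurable upper_noise_measurable]
  have bounds: "\<bar>upper_noise c n\<bar> \<le> 1" "0 \<le> upper_noise c n" "upper_noise c n \<le> 1" for n
    using F_nonneg F_le_1 by (simp_all add: upper_noise_def)
  have F_abs: "\<bar>F r\<bar> \<le> 1" for r using F_nonneg[of r] F_le_1[of r] by simp
  define f :: "real^'d \<Rightarrow> real" where "f w = (if v < w $ x \<and> w $ y \<le> c \<and> w $ z \<le> c then 1 else 0)" for w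
  have [measurable]: "f \<in> borel_measurable borel" unfolding f_def by measurable
  have ind_f: "f (W t \<omega>) = indicator D \<omega> * indicator E \<omega>" if "\<omega> \<in> space M" for \<omega>
    using that by (auto simp: D_def E_def f_def indicator_def)
  let ?q = "expectation (\<lambda>\<omega>. upper_noise c (A (t + 1) \<omega>, B (t + 1) \<omega>))"
  have q: "0 \<le> ?q" using bounds by (intro integral_nonneg_AE) simp
  have "AE \<omega> in M. real_cond_exp M G (\<lambda>\<omega>. upper_noise c (A (t + 1) \<omega>, B (t + 1) \<omega>) * f (W t \<omega>)) \<omega>
      = ?q * real_cond_exp M G (\<lambda>\<omega>. f (W t \<omega>)) \<omega>"
    unfolding G_def
    by (rule real_cond_exp_noise_factor[where C = 1]) (auto simp: f_def bounds)
  moreover have "AE \<omega> in M. real_cond_exp M G (\<lambda>\<omega>. f (W t \<omega>)) \<omega> = real_cond_exp M G (\<lambda>\<omega>. indicator D \<omega> * indicator E \<omega>) \<omega>"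
    by (rule real_cond_exp_cong) (auto simp: ind_f)
  moreover have "AE \<omega> in M. real_cond_exp M G (\<lambda>\<omega>. indicator D \<omega> * indicator E \<omega>) \<omega> = indicator D \<omega> * real_cond_exp M G (indicator E) \<omega>"
    by (rule real_cond_exp_mult) (auto intro!: integrable_const_bound[where B = 1] simp: indicator_def)
  moreover have "AE \<omega> in M. real_cond_exp M G (\<lambda>\<omega>. indicator D \<omega> * (F (Y (t + 1) \<omega>) * indicator E \<omega>)) \<omega>
      = indicator D \<omega> * real_cond_exp M G (\<lambda>\<omega>. F (Y (t + 1) \<omega>) * indicator E \<omega>) \<omega>"
    by (rule real_cond_exp_mult) (auto intro!: integrable_const_bound[where B = 1] simp: indicator_def F_abs)
  moreover have "AE \<omega> in M. real_cond_exp M G (\<lambda>\<omega>. indicator D \<omega> * (F (Y (t + 1) \<omega>) * indicator E \<omega>)) \<omega>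
      \<le> real_cond_exp M G (\<lambda>\<omega>. upper_noise c (A (t + 1) \<omega>, B (t + 1) \<omega>) * f (W t \<omega>)) \<omega>"
  proof (rule real_cond_exp_mono)
    show "AE \<omega> in M. indicator D \<omega> * (F (Y (t + 1) \<omega>) * indicator E \<omega>) \<le> upper_noise c (A (t + 1) \<omega>, B (t + 1) \<omega>) * f (W t \<omega>)"
      using F_Y_upper[OF zero] AE_space
    proof eventually_elim
      case (elim \<omega>)
      then show ?case by (auto simp: ind_f D_def indicator_def)
    qed
    show "integrable M (\<lambda>\<omega>. upper_noise c (A (t + 1) \<omega>, B (t + 1) \<omega>) * f (W t \<omega>))"
      "integrable M (\<lambda>\<omega>. indicator D \<omega> * (F (Y (t + 1) \<omega>) * indicator E \<omega>))"
      by (auto intro!: integrable_const_bound[where B = 1] simp: f_def indicator_def bounds F_abs)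
  qed
  moreover have "AE \<omega> in M. 0 \<le> real_cond_exp M G (indicator E) \<omega>"
    by (rule real_cond_exp_pos) auto
  ultimately show ?thesis
    unfolding tail_cond_exp_def cond_exp_event_def G_def[symmetric] E_def[symmetric]
    using AE_space
  proof eventually_elim
    case (elim \<omega>)
    show ?case
    proof (intro impI)
      assume "Y t \<omega> \<le> c" "Z t \<omega> \<le> c"
      then have "indicator D \<omega> = (1 :: real)" using elim by (simp add: D_def)
      with elim have "real_cond_exp M G (\<lambda>\<omega>. F (Y (t + 1) \<omega>) * indicator E \<omega>) \<omega> \<le> ?q * real_cond_exp M G (indicator E) \<omega>"
        by simp
      then show "real_cond_exp M G (\<lambda>\<omega>. F (Y (t + 1) \<omega>) * indicator E \<omega>) \<omega> / real_cond_exp M G (indicator E) \<omega> \<le> ?q"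
        \<comment> \<open>Where the conditional probability vanishes the quotient is 0, as
          \<open>x / 0 = 0\<close>, and \<open>?q\<close> is non-negative.\<close>
        using elim q by (cases "real_cond_exp M G (indicator E) \<omega> = 0") (simp_all add: divide_simps)
    qed
  qed
qed

text \<open>The bounds at each threshold fail only on a null set, and countably many rational
  thresholds give a common one. Outside it the quotient is squeezed between a deterministic function
  tending to 1 and 1, which also yields existence of the limit.\<close>

lemma causal_tail_coeff_eq_1:
  assumes pos: "AE \<omega> in M. 0 < A (t + 1) \<omega> $ y $ x"
    and rows: "indep_vars (\<lambda>_. borel) (\<lambda>i \<omega>. (A t \<omega> $ i, B t \<omega> $ i)) UNIV"
    and tail: "\<And>v. prob {\<omega>\<in>space M. v < B t \<omega> $ x} > 0"
  shows "AE \<omega> in M. causal_tail_coeff M F X Y Z t \<omega> = 1"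
proof -
  let ?m = "\<lambda>v. expectation (\<lambda>\<omega>. lower_noise v (A (t + 1) \<omega>, B (t + 1) \<omega>))"
  have "(?m \<longlongrightarrow> 1) at_top"
    using tendsto_expectation_cdf_mult[OF prob_space_axioms F_distribution(1) _ pos]
    by (simp add: lower_noise_def F_distribution(2)[symmetric])
  then have lim: "(?m \<longlongrightarrow> 1) threshold_at_top"
    by (rule tendsto_mono[OF inf_le1])
  have "AE \<omega> in M. \<forall>v\<in>\<rat>. 0 \<le> v \<longrightarrow> ?m v \<le> tail_cond_exp M F X Y Z t \<omega> v \<and> tail_cond_exp M F X Y Z t \<omega> v \<le> 1"
    using tail_cond_exp_bounds[OF rows tail]
    by (subst AE_ball_countable[OF countable_rat]) auto
  then show ?thesis
  proof eventually_elim
    case (elim \<omega>)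
    have ev: "\<forall>\<^sub>F v in threshold_at_top. ?m v \<le> tail_cond_exp M F X Y Z t \<omega> v \<and> tail_cond_exp M F X Y Z t \<omega> v \<le> 1"
      unfolding eventually_threshold_at_top
      using eventually_ge_at_top[of 0] by eventually_elim (use elim in auto)
    have "(tail_cond_exp M F X Y Z t \<omega> \<longlongrightarrow> 1) threshold_at_top"
      by (rule tendsto_sandwich[OF _ _ lim tendsto_const]) (use ev in \<open>auto elim: eventually_mono\<close>)
    then show ?case
      unfolding causal_tail_coeff_def by (rule tendsto_Lim[OF threshold_at_top_neq_bot])
  qed
qed

text \<open>The variable is below 1 at every point, so its mean is strictly below 1 even if its
  supremum is 1.\<close>

lemma upper_noise_mean_less_1:
  assumes "\<And>r. F r < 1"
  shows "expectation (\<lambda>\<omega>. upper_noise c (A t \<omega>, B t \<omega>)) < 1"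
proof (rule expectation_less)
  note [measurable] = measurable_compose[OF noise_measurable upper_noise_measurable]
  show "integrable M (\<lambda>\<omega>. upper_noise c (A t \<omega>, B t \<omega>))"
    using F_nonneg F_le_1 by (intro integrable_const_bound[where B = 1]) (auto simp: upper_noise_def)
qed (simp add: upper_noise_def assms)

text \<open>At each sample point some natural number \<open>n\<close> bounds both \<open>Y t\<close>
  and \<open>Z t\<close>, and then \<open>?q (real n) < 1\<close> bounds the quotients at all
  rational thresholds. The gap to 1 depends on the sample point; quantifying over natural
  \<open>n\<close> keeps the null sets countable.\<close>

lemma causal_tail_coeff_less_1:
  assumes zero: "\<And>t. AE \<omega> in M. A t \<omega> $ y $ x = 0" and F_less: "\<And>r. F r < 1"
    and lim: "AE \<omega> in M. \<exists>L. (tail_cond_exp M F X Y Z t \<omega> \<longlongrightarrow> L) threshold_at_top"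
  shows "AE \<omega> in M. causal_tail_coeff M F X Y Z t \<omega> < 1"
proof -
  let ?q = "\<lambda>c. expectation (\<lambda>\<omega>. upper_noise c (A (t + 1) \<omega>, B (t + 1) \<omega>))"
  have "AE \<omega> in M. \<forall>n. \<forall>v\<in>\<rat>. Y t \<omega> \<le> real n \<longrightarrow> Z t \<omega> \<le> real n \<longrightarrow> tail_cond_exp M F X Y Z t \<omega> v \<le> ?q (real n)"
    unfolding AE_all_countable AE_ball_countable[OF countable_rat]
    by (intro allI ballI tail_cond_exp_le[OF zero])
  with lim show ?thesis
  proof eventually_elim
    case (elim \<omega>)
    then obtain L where L: "(tail_cond_exp M F X Y Z t \<omega> \<longlongrightarrow> L) threshold_at_top" by blast
    obtain n where n: "max (Y t \<omega>) (Z t \<omega>) \<le> real n" using real_arch_simple by blast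
    have "\<forall>\<^sub>F v in threshold_at_top. tail_cond_exp M F X Y Z t \<omega> v \<le> ?q (real n)"
      unfolding eventually_threshold_at_top using elim n by (intro always_eventually) auto
    from tendsto_upperbound[OF L this threshold_at_top_neq_bot] have "L \<le> ?q (real n)" .
    also have "\<dots> < 1" by (rule upper_noise_mean_less_1[OF F_less])
    finally show ?case
      unfolding causal_tail_coeff_def using tendsto_Lim[OF threshold_at_top_neq_bot L] by simp
  qed
qed

subsection \<open>The estimator\<close>

definition exceeds :: "real \<Rightarrow> real \<Rightarrow> real \<Rightarrow> real^'d \<Rightarrow> bool" where
  "exceeds \<tau>\<^sub>X \<tau>\<^sub>Y \<tau>\<^sub>Z w \<longleftrightarrow> w $ x \<ge> \<tau>\<^sub>X \<and> w $ y \<le> \<tau>\<^sub>Y \<and> w $ z \<le> \<tau>\<^sub>Z"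

lemma exceeds_measurable [measurable]: "Measurable.pred borel (exceeds \<tau>\<^sub>X \<tau>\<^sub>Y \<tau>\<^sub>Z)"
  unfolding exceeds_def by measurable

lemma exceedance_times_eq:
  "exceedance_times X Y Z \<tau>\<^sub>X \<tau>\<^sub>Y \<tau>\<^sub>Z n \<omega> = {k\<in>{1..int n - 1}. exceeds (\<tau>\<^sub>X n) \<tau>\<^sub>Y \<tau>\<^sub>Z (W k \<omega>)}"
  by (simp add: exceedance_times_def exceeds_def)

lemma sum_exceedance_times:
  "(\<Sum>k\<in>exceedance_times X Y Z \<tau>\<^sub>X \<tau>\<^sub>Y \<tau>\<^sub>Z n \<omega>. h k)
    = (\<Sum>k\<in>{1..int n - 1}. if exceeds (\<tau>\<^sub>X n) \<tau>\<^sub>Y \<tau>\<^sub>Z (W k \<omega>) then h k else 0)"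
  unfolding exceedance_times_eq by (rule sum.inter_filter) simp

lemma card_exceedance_times_measurable [measurable]:
  "(\<lambda>\<omega>. real (card (exceedance_times X Y Z \<tau>\<^sub>X \<tau>\<^sub>Y \<tau>\<^sub>Z n \<omega>))) \<in> borel_measurable M"
  unfolding real_of_card sum_exceedance_times by measurable

lemma tail_coeff_estimator_measurable [measurable]:
  "tail_coeff_estimator F X Y Z \<tau>\<^sub>X \<tau>\<^sub>Y \<tau>\<^sub>Z n \<in> borel_measurable M"
  unfolding tail_coeff_estimator_def[abs_def] sum_exceedance_times by measurable

text \<open>All summands are at most 1, which removes the absolute value. The count must be
  positive: for an empty selection the estimator is \<open>0 / 0 = 0\<close>.\<close>

lemma one_minus_tail_coeff_estimator:
  assumes "0 < card (exceedance_times X Y Z \<tau>\<^sub>X \<tau>\<^sub>Y \<tau>\<^sub>Z n \<omega>)"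
  shows "\<bar>tail_coeff_estimator F X Y Z \<tau>\<^sub>X \<tau>\<^sub>Y \<tau>\<^sub>Z n \<omega> - 1\<bar> * real (card (exceedance_times X Y Z \<tau>\<^sub>X \<tau>\<^sub>Y \<tau>\<^sub>Z n \<omega>))
    = (\<Sum>k\<in>exceedance_times X Y Z \<tau>\<^sub>X \<tau>\<^sub>Y \<tau>\<^sub>Z n \<omega>. 1 - F (Y (k + 1) \<omega>))"
proof -
  let ?S = "exceedance_times X Y Z \<tau>\<^sub>X \<tau>\<^sub>Y \<tau>\<^sub>Z n \<omega>"
  let ?\<Sigma> = "\<Sum>k\<in>?S. F (Y (k + 1) \<omega>)"
  have "?\<Sigma> \<le> (\<Sum>k\<in>?S. 1)" by (intro sum_mono F_le_1)
  then have "?\<Sigma> / real (card ?S) \<le> 1" using assms by (simp add: divide_simps)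
  then have "\<bar>?\<Sigma> / real (card ?S) - 1\<bar> = 1 - ?\<Sigma> / real (card ?S)" by simp
  then show ?thesis
    using assms by (simp add: tail_coeff_estimator_def sum_subtractf left_diff_distrib)
qed

text \<open>At selected times \<open>X k\<close> is at least \<open>\<tau>\<^sub>X n\<close>, so
  \<open>1 - F (Y (k + 1) \<omega>)\<close> is at most \<open>u n\<close> of the next noise, whose
  mean tends to 0. A deviation above \<open>e\<close> then forces either few selected times
  (\<open>few\<close>) or an untypically large selected average of \<open>u n\<close>
  (\<open>bad\<close>).\<close>

lemma estimator_converges:
  fixes \<tau>\<^sub>X :: "nat \<Rightarrow> real"
  assumes pos: "\<And>t. AE \<omega> in M. 0 < A t \<omega> $ y $ x"
    and threshold: "filterlim \<tau>\<^sub>X at_top sequentially"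
    and sample: "diverges_in_prob M (\<lambda>n \<omega>. real (card (exceedance_times X Y Z \<tau>\<^sub>X \<tau>\<^sub>Y \<tau>\<^sub>Z n \<omega>)))"
  shows "converges_in_prob M (tail_coeff_estimator F X Y Z \<tau>\<^sub>X \<tau>\<^sub>Y \<tau>\<^sub>Z) 1"
  unfolding converges_in_prob_def
proof (intro allI impI)
  fix e :: real assume e: "0 < e"
  define S where "S = exceedance_times X Y Z \<tau>\<^sub>X \<tau>\<^sub>Y \<tau>\<^sub>Z"
  define u where "u n w = 1 - lower_noise (\<tau>\<^sub>X n) w" for n w
  define p where "p n = prob {\<omega>\<in>space M. \<bar>tail_coeff_estimator F X Y Z \<tau>\<^sub>X \<tau>\<^sub>Y \<tau>\<^sub>Z n \<omega> - 1\<bar> > e}" for n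
  have u [measurable]: "u n \<in> borel_measurable borel" for n
    unfolding u_def by measurable
  have u_bounds: "0 \<le> u n w" "u n w \<le> 1" for n w
    using F_nonneg F_le_1 by (simp_all add: u_def lower_noise_def)
  note [measurable] = measurable_compose[OF noise_measurable lower_noise_measurable]
    measurable_compose[OF noise_measurable u]
  have "((\<lambda>v. expectation (\<lambda>\<omega>. lower_noise v (A 0 \<omega>, B 0 \<omega>))) \<longlongrightarrow> 1) at_top"
    using tendsto_expectation_cdf_mult[OF prob_space_axioms F_distribution(1) _ pos[of 0]]
    by (simp add: lower_noise_def F_distribution(2)[symmetric])
  from filterlim_compose[OF this threshold]
  have "(\<lambda>n. expectation (\<lambda>\<omega>. lower_noise (\<tau>\<^sub>X n) (A 0 \<omega>, B 0 \<omega>))) \<longlonglongrightarrow> 1" .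
  then have mean_lim: "(\<lambda>n. 1 - expectation (\<lambda>\<omega>. lower_noise (\<tau>\<^sub>X n) (A 0 \<omega>, B 0 \<omega>))) \<longlonglongrightarrow> 1 - 1"
    by (intro tendsto_intros)
  have mean: "expectation (\<lambda>\<omega>. u n (A k \<omega>, B k \<omega>)) = 1 - expectation (\<lambda>\<omega>. lower_noise (\<tau>\<^sub>X n) (A 0 \<omega>, B 0 \<omega>))" for n k
  proof -
    have "integrable M (\<lambda>\<omega>. lower_noise (\<tau>\<^sub>X n) (A k \<omega>, B k \<omega>))"
      using F_nonneg F_le_1 by (intro integrable_const_bound[where B = 1]) (auto simp: lower_noise_def)
    then show ?thesis
      using expectation_noise_eq[OF lower_noise_measurable, of "\<tau>\<^sub>X n" k 0] by (simp add: u_def prob_space)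
  qed
  have "p \<longlonglongrightarrow> 0"
  proof (rule LIMSEQ_I)
    fix \<eta> :: real assume \<eta>: "0 < \<eta>"
    have "((\<lambda>K. exp (- (e / 2 * K))) \<longlongrightarrow> 0) at_top"
      using e by real_asymp
    then have "\<forall>\<^sub>F K in at_top. exp (- (e / 2 * K)) < \<eta> / 2 \<and> 0 < K"
      using \<eta> by (intro eventually_conj order_tendstoD(2)[where a = "\<eta> / 2"] eventually_gt_at_top) auto
    \<comment> \<open>The bound on \<open>bad\<close> depends on \<open>K\<close> but not on
      \<open>n\<close>, so \<open>K\<close> can be fixed first; each of the two events receives half
      of \<open>\<eta>\<close>.\<close>
    then obtain K where K: "exp (- (e / 2 * K)) < \<eta> / 2" "0 < K"
      unfolding eventually_at_top_linorder by blast
    have "(\<lambda>n. prob {\<omega>\<in>space M. real (card (S n \<omega>)) > K}) \<longlonglongrightarrow> 1"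
      using sample by (simp add: diverges_in_prob_def S_def)
    then have "\<forall>\<^sub>F n in sequentially. 1 - \<eta> / 2 < prob {\<omega>\<in>space M. real (card (S n \<omega>)) > K}"
      using \<eta> by (intro order_tendstoD(1)) auto
    \<comment> \<open>The bound \<open>e / 4\<close> meets the requirement
      \<open>4 * \<mu> \<le> \<delta>\<close> of \<open>selected_mean_small\<close> with
      \<open>\<delta> = e\<close>.\<close>
    moreover have "\<forall>\<^sub>F n in sequentially. 1 - expectation (\<lambda>\<omega>. lower_noise (\<tau>\<^sub>X n) (A 0 \<omega>, B 0 \<omega>)) < e / 4"
      using mean_lim e by (intro order_tendstoD(2)) auto
    moreover have "\<forall>\<^sub>F n in sequentially. 0 \<le> \<tau>\<^sub>X n"
      using threshold by (auto simp: filterlim_at_top)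
    ultimately have "\<forall>\<^sub>F n in sequentially. p n < \<eta>"
    proof eventually_elim
      case (elim n)
      have S: "S n \<omega> = {k\<in>{1..int n - 1}. exceeds (\<tau>\<^sub>X n) \<tau>\<^sub>Y \<tau>\<^sub>Z (W k \<omega>)}" for \<omega>
        unfolding S_def by (rule exceedance_times_eq)
      define bad where "bad = {\<omega>\<in>space M. K < real (card (S n \<omega>)) \<and>
        e * real (card (S n \<omega>)) < (\<Sum>k\<in>S n \<omega>. u n (A (k + 1) \<omega>, B (k + 1) \<omega>))}"
      define few where "few = {\<omega>\<in>space M. real (card (S n \<omega>)) \<le> K}"
      have [measurable]: "bad \<in> sets M" "few \<in> sets M"
        unfolding bad_def few_def S_def sum_exceedance_times by measurable
      have "prob bad \<le> exp (- (e / 2 * K))"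
        unfolding bad_def S
        by (rule selected_mean_small[where \<mu> = "1 - expectation (\<lambda>\<omega>. lower_noise (\<tau>\<^sub>X n) (A 0 \<omega>, B 0 \<omega>))"])
           (use u_bounds mean e elim in auto)
      moreover have "prob few < \<eta> / 2"
      proof -
        have "few = space M - {\<omega>\<in>space M. real (card (S n \<omega>)) > K}" by (auto simp: few_def)
        moreover have "{\<omega>\<in>space M. real (card (S n \<omega>)) > K} \<in> sets M" unfolding S_def by measurable
        ultimately have "prob few = 1 - prob {\<omega>\<in>space M. real (card (S n \<omega>)) > K}"
          by (simp add: prob_compl)
        then show ?thesis using elim by simp
      qed
      moreover have "p n \<le> prob (bad \<union> few)"
        unfolding p_def
      proof (rule finite_measure_mono_AE)
        show "AE \<omega> in M. \<omega> \<in> {\<omega>\<in>space M. \<bar>tail_coeff_estimator F X Y Z \<tau>\<^sub>X \<tau>\<^sub>Y \<tau>\<^sub>Z n \<omega> - 1\<bar> > e} \<longrightarrow> \<omega> \<in> bad \<union> few"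
          using F_Y_lower
        proof (eventually_elim, safe)
          fix \<omega> assume *: "\<forall>t v. 0 \<le> v \<longrightarrow> v \<le> X t \<omega> \<longrightarrow> lower_noise v (A (t + 1) \<omega>, B (t + 1) \<omega>) \<le> F (Y (t + 1) \<omega>)"
            "\<omega> \<in> space M" "\<bar>tail_coeff_estimator F X Y Z \<tau>\<^sub>X \<tau>\<^sub>Y \<tau>\<^sub>Z n \<omega> - 1\<bar> > e" "\<omega> \<notin> few"
          then have card: "K < real (card (S n \<omega>))" by (simp add: few_def)
          then have "e * real (card (S n \<omega>)) < \<bar>tail_coeff_estimator F X Y Z \<tau>\<^sub>X \<tau>\<^sub>Y \<tau>\<^sub>Z n \<omega> - 1\<bar> * real (card (S n \<omega>))"
            using * K by (intro mult_strict_right_mono) auto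
          also have "\<dots> = (\<Sum>k\<in>S n \<omega>. 1 - F (Y (k + 1) \<omega>))"
            using card K unfolding S_def by (intro one_minus_tail_coeff_estimator) simp
          also have "\<dots> \<le> (\<Sum>k\<in>S n \<omega>. u n (A (k + 1) \<omega>, B (k + 1) \<omega>))"
            using * elim by (intro sum_mono) (auto simp: S exceeds_def u_def)
          finally show "\<omega> \<in> bad" using card * by (simp add: bad_def)
        qed
      qed measurable
      moreover have "prob (bad \<union> few) \<le> prob bad + prob few"
        by (rule measure_Un_le) auto
      ultimately show "p n < \<eta>" using K by linarith
    qed
    then show "\<exists>n0. \<forall>n\<ge>n0. norm (p n - 0) < \<eta>"
      by (simp add: eventually_sequentially p_def)
  qed
  then show "(\<lambda>n. prob {\<omega>\<in>space M. \<bar>tail_coeff_estimator F X Y Z \<tau>\<^sub>X \<tau>\<^sub>Y \<tau>\<^sub>Z n \<omega> - 1\<bar> > e}) \<longlonglongrightarrow> 0"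
    unfolding p_def .
qed

text \<open>At selected times \<open>1 - F (Y (k + 1) \<omega>)\<close> is at least \<open>u\<close>
  of the next noise, whose mean \<open>p\<close> is positive and does not depend on
  \<open>n\<close>. With more than one selected time the estimator therefore stays more than
  \<open>p / 4\<close> away from 1, except with probability at most \<open>exp (- (p / 4))\<close>.
  Convergence to 1 would give \<open>1 \<le> exp (- (p / 4))\<close> in the limit.\<close>

lemma estimator_not_converges:
  assumes zero: "\<And>t. AE \<omega> in M. A t \<omega> $ y $ x = 0" and F_less: "\<And>r. F r < 1"
    and sample: "diverges_in_prob M (\<lambda>n \<omega>. real (card (exceedance_times X Y Z \<tau>\<^sub>X \<tau>\<^sub>Y \<tau>\<^sub>Z n \<omega>)))"
  shows "\<not> converges_in_prob M (tail_coeff_estimator F X Y Z \<tau>\<^sub>X \<tau>\<^sub>Y \<tau>\<^sub>Z) 1"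
proof
  assume conv: "converges_in_prob M (tail_coeff_estimator F X Y Z \<tau>\<^sub>X \<tau>\<^sub>Y \<tau>\<^sub>Z) 1"
  define S where "S = exceedance_times X Y Z \<tau>\<^sub>X \<tau>\<^sub>Y \<tau>\<^sub>Z"
  define c where "c = max \<tau>\<^sub>Y \<tau>\<^sub>Z"
  define u where "u w = 1 - upper_noise c w" for w
  define p where "p = 1 - expectation (\<lambda>\<omega>. upper_noise c (A 0 \<omega>, B 0 \<omega>))"
  have p: "0 < p" using upper_noise_mean_less_1[OF F_less] by (simp add: p_def)
  have u [measurable]: "u \<in> borel_measurable borel"
    unfolding u_def by measurable
  have u_bounds: "0 \<le> u w" "u w \<le> 1" for w
    using F_nonneg F_le_1 by (simp_all add: u_def upper_noise_def)
  note [measurable] = measurable_compose[OF noise_measurable upper_noise_measurable]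
    measurable_compose[OF noise_measurable u]
  have mean: "expectation (\<lambda>\<omega>. u (A k \<omega>, B k \<omega>)) = p" for k
  proof -
    have "integrable M (\<lambda>\<omega>. upper_noise c (A k \<omega>, B k \<omega>))"
      using F_nonneg F_le_1 by (intro integrable_const_bound[where B = 1]) (auto simp: upper_noise_def)
    then show ?thesis
      using expectation_noise_eq[OF upper_noise_measurable, of c k 0] by (simp add: u_def p_def prob_space)
  qed
  define far where "far n = {\<omega>\<in>space M. \<bar>tail_coeff_estimator F X Y Z \<tau>\<^sub>X \<tau>\<^sub>Y \<tau>\<^sub>Z n \<omega> - 1\<bar> > p / 4}" for n
  \<comment> \<open>A fixed count bound such as 1 is enough: the exceptional probability only has to
    stay below 1, not tend to 0.\<close>
  have "prob {\<omega>\<in>space M. real (card (S n \<omega>)) > 1} \<le> prob (far n) + exp (- (p / 4 * 1))" for n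
  proof -
    have S: "S n \<omega> = {k\<in>{1..int n - 1}. exceeds (\<tau>\<^sub>X n) \<tau>\<^sub>Y \<tau>\<^sub>Z (W k \<omega>)}" for \<omega>
      unfolding S_def by (rule exceedance_times_eq)
    define near where "near = {\<omega>\<in>space M. 1 < real (card (S n \<omega>)) \<and>
      (\<Sum>k\<in>S n \<omega>. u (A (k + 1) \<omega>, B (k + 1) \<omega>)) \<le> p / 4 * real (card (S n \<omega>))}"
    have [measurable]: "near \<in> sets M" "far n \<in> sets M"
      unfolding near_def far_def S_def sum_exceedance_times by measurable
    have "prob {\<omega>\<in>space M. real (card (S n \<omega>)) > 1} \<le> prob (far n \<union> near)"
    proof (rule finite_measure_mono_AE)
      show "AE \<omega> in M. \<omega> \<in> {\<omega>\<in>space M. real (card (S n \<omega>)) > 1} \<longrightarrow> \<omega> \<in> far n \<union> near"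
        using F_Y_upper[OF zero]
      proof (eventually_elim, safe)
        fix \<omega> assume *: "\<forall>t c. Y t \<omega> \<le> c \<longrightarrow> Z t \<omega> \<le> c \<longrightarrow> F (Y (t + 1) \<omega>) \<le> upper_noise c (A (t + 1) \<omega>, B (t + 1) \<omega>)"
          "\<omega> \<in> space M" "1 < real (card (S n \<omega>))" "\<omega> \<notin> near"
        then have "p / 4 * real (card (S n \<omega>)) < (\<Sum>k\<in>S n \<omega>. u (A (k + 1) \<omega>, B (k + 1) \<omega>))"
          by (simp add: near_def)
        also have "\<dots> \<le> (\<Sum>k\<in>S n \<omega>. 1 - F (Y (k + 1) \<omega>))"
          using * by (intro sum_mono) (auto simp: S exceeds_def u_def c_def)
        also have "\<dots> = \<bar>tail_coeff_estimator F X Y Z \<tau>\<^sub>X \<tau>\<^sub>Y \<tau>\<^sub>Z n \<omega> - 1\<bar> * real (card (S n \<omega>))"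
          using * unfolding S_def by (intro one_minus_tail_coeff_estimator[symmetric]) simp
        finally have "p / 4 < \<bar>tail_coeff_estimator F X Y Z \<tau>\<^sub>X \<tau>\<^sub>Y \<tau>\<^sub>Z n \<omega> - 1\<bar>"
          by (rule mult_right_less_imp_less) simp
        then show "\<omega> \<in> far n" using * by (simp add: far_def)
      qed
    qed measurable
    also have "\<dots> \<le> prob (far n) + prob near"
      by (rule measure_Un_le) auto
    also have "prob near \<le> exp (- (p / 4 * 1))"
      unfolding near_def S
      by (rule selected_mean_large) (use u_bounds mean p in auto)
    finally show ?thesis by simp
  qed
  moreover have "(\<lambda>n. prob {\<omega>\<in>space M. real (card (S n \<omega>)) > 1}) \<longlonglongrightarrow> 1"
    using sample unfolding diverges_in_prob_def S_def by blast
  moreover have "(\<lambda>n. prob (far n)) \<longlonglongrightarrow> 0"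
    using conv[unfolded converges_in_prob_def, rule_format, of "p / 4"] p by (simp add: far_def)
  then have "(\<lambda>n. prob (far n) + exp (- (p / 4 * 1))) \<longlonglongrightarrow> 0 + exp (- (p / 4 * 1))"
    by (intro tendsto_intros)
  ultimately have "1 \<le> 0 + exp (- (p / 4 * 1))"
    using LIMSEQ_le by blast
  then show False using p by simp
qed

end

section \<open>The equivalence, by cases on the coefficient of \<open>X\<close> in the equation for
  \<open>Y\<close>\<close>

theorem theorem3:
  fixes M :: "'a measure"
    and A :: "int \<Rightarrow> 'a \<Rightarrow> real^3^3"
    and B W :: "int \<Rightarrow> 'a \<Rightarrow> real^3"
    and X Y Z :: "int \<Rightarrow> 'a \<Rightarrow> real"
    and N :: "real measure"
    and F :: "real \<Rightarrow> real"
    and \<tau>\<^sub>X :: "nat \<Rightarrow> real"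
    and \<tau>\<^sub>Y \<tau>\<^sub>Z :: real
    and t\<^sub>0 :: int
  assumes "prob_space M"
    and W_def: "\<And>t \<omega>. W t \<omega> = vector [Z t \<omega>, X t \<omega>, Y t \<omega>]"
    and W_measurable: "\<And>t. W t \<in> borel_measurable M"
    and indep: "prob_space.indep_vars M (\<lambda>_. borel) (\<lambda>t \<omega>. (A t \<omega>, B t \<omega>)) UNIV"
    and ident_distr: "\<And>s t. distr M borel (\<lambda>\<omega>. (A s \<omega>, B s \<omega>)) = distr M borel (\<lambda>\<omega>. (A t \<omega>, B t \<omega>))"
    and nonneg: "\<And>t i. AE \<omega> in M. B t \<omega> $ i \<ge> 0"
      "\<And>t i j. AE \<omega> in M. A t \<omega> $ i $ j \<ge> 0"
    and recurrence: "\<And>t. AE \<omega> in M. W t \<omega> = A t \<omega> *v W (t - 1) \<omega> + B t \<omega>"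
    and stationary_solution: "\<And>t. AE \<omega> in M.
          (\<lambda>i. sre_prod (\<lambda>s. A s \<omega>) t i *v B (t - int i) \<omega>) sums W t \<omega>"
    and tail_support: "\<And>t. \<exists>K. {K<..} \<subseteq> dist_support (distr M borel (\<lambda>\<omega>. B t \<omega> $ 2))"
      "\<And>t. \<exists>K. {K<..} \<subseteq> dist_support (distr M borel (\<lambda>\<omega>. B t \<omega> $ 3))"
    and B1: "\<And>t. ext_expectation M (\<lambda>\<omega>. ext_log (onorm (\<lambda>v. A t \<omega> *v v))) < 0"
      "\<And>t. ext_expectation M (\<lambda>\<omega>. max (ext_log (norm (B t \<omega>))) 0) < \<infinity>"
    and B2: "\<And>t. prob_space.indep_vars M (\<lambda>_. borel) (\<lambda>i \<omega>. (A t \<omega> $ i, B t \<omega> $ i)) (UNIV :: 3 set)"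
    and B4: "\<And>t i j. measure M {\<omega> \<in> space M. A t \<omega> $ i $ j = 0} \<noteq> 1
          \<Longrightarrow> AE \<omega> in M. A t \<omega> $ i $ j > 0"
    and F_cdf: "real_distribution N" "F = cdf N"
    and F_less_1: "\<And>x. F x < 1"
    and limit_exists: "AE \<omega> in M. \<exists>L. (tail_cond_exp M F X Y Z t\<^sub>0 \<omega> \<longlongrightarrow> L) threshold_at_top"
    and threshold: "filterlim \<tau>\<^sub>X at_top sequentially"
    and sample_size: "diverges_in_prob M
          (\<lambda>n \<omega>. real (card (exceedance_times X Y Z \<tau>\<^sub>X \<tau>\<^sub>Y \<tau>\<^sub>Z n \<omega>)))"
  shows "converges_in_prob M (tail_coeff_estimator F X Y Z \<tau>\<^sub>X \<tau>\<^sub>Y \<tau>\<^sub>Z) 1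
     \<longleftrightarrow> (AE \<omega> in M. causal_tail_coeff M F X Y Z t\<^sub>0 \<omega> = 1)"
proof -
  interpret prob_space M by fact
  \<comment> \<open>The vector is ordered as \<open>Z\<close>, \<open>X\<close>, \<open>Y\<close>,
    so the coordinates \<open>x\<close>, \<open>y\<close>, \<open>z\<close> of the locale are 2, 3,
    1.\<close>
  have UNIV_3': "(UNIV :: 3 set) = {2, 3, 1}" using UNIV_3 by auto
  interpret sre: tail_sre M A B W 2 3 1 N F
    by (intro tail_sre.intro stationary_sre.intro stationary_sre_axioms.intro tail_sre_axioms.intro)
      (rule prob_space_axioms W_measurable indep stationary_solution UNIV_3' ident_distr nonneg recurrence F_cdf | simp)+
  have XYZ: "X = (\<lambda>s \<omega>. W s \<omega> $ 2)" "Y = (\<lambda>s \<omega>. W s \<omega> $ 3)" "Z = (\<lambda>s \<omega>. W s \<omega> $ 1)"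
    by (simp_all add: W_def fun_eq_iff)
  have tail: "0 < prob {\<omega>\<in>space M. v < B t \<omega> $ 2}" for t v
  proof -
    obtain K where "{K<..} \<subseteq> dist_support (distr M borel (\<lambda>\<omega>. B t \<omega> $ 2))"
      using tail_support(1) by blast
    \<comment> \<open>Any support point above \<open>v\<close> works: \<open>{v<..}\<close> is an
      open neighbourhood of it and so has positive mass.\<close>
    then have "max K v + 1 \<in> dist_support (distr M borel (\<lambda>\<omega>. B t \<omega> $ 2))" by auto
    then have "0 < emeasure (distr M borel (\<lambda>\<omega>. B t \<omega> $ 2)) {v<..}"
      by (auto simp: dist_support_def)
    also have "\<dots> = prob {\<omega>\<in>space M. v < B t \<omega> $ 2}"
      by (subst emeasure_distr) (auto simp: emeasure_eq_measure intro!: arg_cong[where f = prob])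
    finally show ?thesis by simp
  qed
  show ?thesis
  \<comment> \<open>Entry \<open>$ 3 $ 2\<close> is the coefficient of \<open>X\<close> in the
    equation for \<open>Y\<close>. Identical distribution carries the case made at time 0 to all
    times, and \<open>B4\<close> turns "not almost surely 0" into "almost surely positive".\<close>
  proof (cases "prob {\<omega> \<in> space M. A 0 \<omega> $ 3 $ 2 = 0} = 1")
    case True
    have zero: "AE \<omega> in M. A t \<omega> $ 3 $ 2 = 0" for t
    proof -
      have "prob {\<omega> \<in> space M. A t \<omega> $ 3 $ 2 = 0} = 1"
        using True sre.prob_noise_eq[of "\<lambda>n. fst n $ 3 $ 2 = 0" t 0] by simp
      then show ?thesis by (subst (asm) prob_eq_1) auto
    qed
    have less_1: "AE \<omega> in M. causal_tail_coeff M F X Y Z t\<^sub>0 \<omega> < 1"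
      unfolding XYZ by (rule sre.causal_tail_coeff_less_1[OF zero F_less_1 limit_exists[unfolded XYZ]])
    have "\<not> (AE \<omega> in M. causal_tail_coeff M F X Y Z t\<^sub>0 \<omega> = 1)"
    proof
      assume "AE \<omega> in M. causal_tail_coeff M F X Y Z t\<^sub>0 \<omega> = 1"
      with less_1 have "AE \<omega> in M. False" by eventually_elim simp
      then show False by simp
    qed
    moreover have "\<not> converges_in_prob M (tail_coeff_estimator F X Y Z \<tau>\<^sub>X \<tau>\<^sub>Y \<tau>\<^sub>Z) 1"
      unfolding XYZ by (rule sre.estimator_not_converges[OF zero F_less_1 sample_size[unfolded XYZ]])
    ultimately show ?thesis by blast
  next
    case False
    have pos: "AE \<omega> in M. 0 < A t \<omega> $ 3 $ 2" for t
      using False sre.prob_noise_eq[of "\<lambda>n. fst n $ 3 $ 2 = 0" t 0] by (intro B4) simp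
    have "AE \<omega> in M. causal_tail_coeff M F X Y Z t\<^sub>0 \<omega> = 1"
      unfolding XYZ by (rule sre.causal_tail_coeff_eq_1[OF pos B2 tail])
    moreover have "converges_in_prob M (tail_coeff_estimator F X Y Z \<tau>\<^sub>X \<tau>\<^sub>Y \<tau>\<^sub>Z) 1"
      unfolding XYZ by (rule sre.estimator_converges[OF pos threshold sample_size[unfolded XYZ]])
    ultimately show ?thesis by blast
  qed
qed

end
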